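(* Let $n\ge 1$ and $d>3$, and let $f,g\in\mathbb{C}[x_0,\dots,x_n]$ be two homogeneous polynomials of degree $d$ such that $V(f)\neq V(g)$, i.e. $f\notin\mathbb{C}^*g$. Assume that $mdr_0(g)$, the minimal degree of a syzygy involving the partial derivatives of $g$, is at least $3$. If $T_f(G\cdot f)=T_g(G\cdot g)$, then either the hypersurface $V(g)\subset\mathbb{P}^n$ has a singularity of multiplicity $d-1$, or $g$ is of Sebastiani-Thom type.
   Context: Work over $\mathbb{C}$; $S=\mathbb{C}[x_0,\dots,x_n]$ with its standard grading, and $S_d$ is its degree $d$ component. A homogeneous polynomial of degree $d$ is understood to be nonzero. For a homogeneous polynomial $f\in S$ write $f_i=\partial f/\partial x_i$ and let $J_f=(f_0,\dots,f_n)\subset S$ be the Jacobian ideal. The group $G=GL_{n+1}(\mathbb{C})$ acts on $S_d$ by linear substitutions of the variables, and the tangent space at $f$ to the orbit $G\cdot f$, viewed as a linear subspace of $S_d$, is $T_f(G\cdot f)=J_{f,d}$, the degree $d$ component of $J_f$, i.e. the span of all $x_if_j$, $0\le i,j\le n$. Let $AR(g)\subset S^{n+1}$ be the graded submodule of all relations among the partial derivatives $g_j$ of $g$: $a=(a_0,\dots,a_n)\in AR(g)_m$ if and only if all $a_j\in S_m$ and $a_0g_0+\dots+a_ng_n=0$. Then $mdr_0(g)=\min\{m: AR(g)_m\neq 0\}$. $V(f)\subset\mathbb{P}^n$ is the projective hypersurface $f=0$, taken with its scheme structure (so $V(f)\ne V(g)$ means precisely $f\notin\mathbb{C}^*g$).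 A point $p\in V(g)$ has multiplicity $m$ if a local equation of $V(g)$ at $p$ lies in $\mathfrak{m}_p^m$ but not in $\mathfrak{m}_p^{m+1}$; it is a singularity if $m\ge 2$. A homogeneous polynomial $f$ of degree $d$ is of Sebastiani-Thom type (ST type) if, for some choice of homogeneous (linear) coordinates $(x_0,\dots,x_n)$ of $\mathbb{P}^n$, some $0\le l\le n-1$, and some forms $p,q$, each either zero or homogeneous of degree $d$, one has $f(x_0,\dots,x_n)=p(x_0,\dots,x_l)+q(x_{l+1},\dots,x_n)$. The case $q=0$ is allowed (then $f$ is called a cone). *)

theory Defs
  imports
    Complex_Main
    "HOL-Library.Poly_Mapping"
    "HOL-Computational_Algebra.Fraction_Field"
begin

text \<open>
  A polynomial is a finitely supported map from monomials to coefficients, a monomial being a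
  finitely supported exponent vector; multiplication is the convolution product of Poly_Mapping.
  The type has countably many variables \<open>x\<^sub>0, x\<^sub>1, \<dots>\<close>; the ring \<open>\<complex>[x\<^sub>0,\<dots>,x\<^sub>n]\<close> is carved out
  as a subset.
\<close>

type_synonym monom = "nat \<Rightarrow>\<^sub>0 nat"
type_synonym mpoly = "monom \<Rightarrow>\<^sub>0 complex"

definition Const :: "complex \<Rightarrow> mpoly" where
  "Const c = Poly_Mapping.single 0 c"

definition mdeg :: "monom \<Rightarrow> nat" where
  "mdeg m = (\<Sum>i\<in>Poly_Mapping.keys m. Poly_Mapping.lookup m i)"

definition polys :: "nat set \<Rightarrow> mpoly set" where
  "polys I = {f. \<forall>m\<in>Poly_Mapping.keys f. Poly_Mapping.keys m \<subseteq> I}"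

text \<open>As a vector space, the degree \<open>d\<close> component contains 0.\<close>

definition forms :: "nat set \<Rightarrow> nat \<Rightarrow> mpoly set" where
  "forms I d = {f \<in> polys I. \<forall>m\<in>Poly_Mapping.keys f. mdeg m = d}"

abbreviation S_ring :: "nat \<Rightarrow> mpoly set" where
  "S_ring n \<equiv> polys {..n}"

abbreviation S_comp :: "nat \<Rightarrow> nat \<Rightarrow> mpoly set" where
  "S_comp n d \<equiv> forms {..n} d"

definition homogeneous :: "nat \<Rightarrow> nat \<Rightarrow> mpoly \<Rightarrow> bool" where
  "homogeneous n d f \<longleftrightarrow> f \<in> S_comp n d \<and> f \<noteq> 0"

text \<open>
  The ring homomorphism extending \<open>\<phi>\<close> on coefficients and sending \<open>x\<^sub>i\<close> to \<open>v i\<close>; it covers both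
  evaluation at a point and substitution of polynomials for the variables.
\<close>

definition mp_eval :: "(complex \<Rightarrow> 'b::comm_semiring_1) \<Rightarrow> (nat \<Rightarrow> 'b) \<Rightarrow> mpoly \<Rightarrow> 'b" where
  "mp_eval \<phi> v f = (\<Sum>m\<in>Poly_Mapping.keys f.
     \<phi> (Poly_Mapping.lookup f m) * (\<Prod>i\<in>Poly_Mapping.keys m. v i ^ Poly_Mapping.lookup m i))"

abbreviation eval_at :: "(nat \<Rightarrow> complex) \<Rightarrow> mpoly \<Rightarrow> complex" where
  "eval_at p \<equiv> mp_eval (\<lambda>c. c) p"

abbreviation substitute :: "(nat \<Rightarrow> mpoly) \<Rightarrow> mpoly \<Rightarrow> mpoly" where
  "substitute y \<equiv> mp_eval Const y"

text \<open>
  Subtraction of exponent vectors truncates at 0, but only where the coefficient vanishes anyway.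
\<close>

definition partial :: "nat \<Rightarrow> mpoly \<Rightarrow> mpoly" where
  "partial i f = (\<Sum>m\<in>Poly_Mapping.keys f.
     Poly_Mapping.single (m - Poly_Mapping.single i 1)
       (of_nat (Poly_Mapping.lookup m i) * Poly_Mapping.lookup f m))"

definition jacobian_ideal :: "nat \<Rightarrow> mpoly \<Rightarrow> mpoly set" where
  "jacobian_ideal n f = {\<Sum>j\<le>n. a j * partial j f | a. \<forall>j\<le>n. a j \<in> S_ring n}"

text \<open>
  For \<open>f\<close> homogeneous of degree \<open>d\<close>: the tangent space at \<open>f\<close> to its orbit under \<open>GL\<^sub>n\<^sub>+\<^sub>1\<close>,
  as a subspace of the degree \<open>d\<close> forms, i.e. the span of all \<open>x\<^sub>i \<partial>f/\<partial>x\<^sub>j\<close>.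
\<close>

definition orbit_tangent_space :: "nat \<Rightarrow> nat \<Rightarrow> mpoly \<Rightarrow> mpoly set" where
  "orbit_tangent_space n d f = jacobian_ideal n f \<inter> S_comp n d"

text \<open>Tuples \<open>(a\<^sub>0,\<dots>,a\<^sub>n)\<close> are functions on \<open>nat\<close> that vanish beyond \<open>n\<close>.\<close>

definition AR :: "nat \<Rightarrow> mpoly \<Rightarrow> nat \<Rightarrow> (nat \<Rightarrow> mpoly) set" where
  "AR n g m = {a. (\<forall>j\<le>n. a j \<in> S_comp n m) \<and> (\<forall>j>n. a j = 0) \<and>
                  (\<Sum>j\<le>n. a j * partial j g) = 0}"

text \<open>
  The minimum exists when \<open>n \<ge> 1\<close> and \<open>g\<close> is homogeneous of degree \<open>\<ge> 1\<close>, because of the Koszul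
  relations.
\<close>

definition mdr0 :: "nat \<Rightarrow> mpoly \<Rightarrow> nat" where
  "mdr0 n g = (LEAST m. AR n g m \<noteq> {\<lambda>_. 0})"

text \<open>
  For homogeneous polynomials, equality of \<open>V(f)\<close> and \<open>V(g)\<close> as subschemes of projective space.
\<close>

definition same_hypersurface :: "mpoly \<Rightarrow> mpoly \<Rightarrow> bool" where
  "same_hypersurface f g \<longleftrightarrow> (\<exists>c. c \<noteq> 0 \<and> f = Const c * g)"

text \<open>Homogeneous coordinates of a point of projective \<open>n\<close>-space; entries beyond \<open>n\<close> are irrelevant.\<close>

definition proj_point :: "nat \<Rightarrow> (nat \<Rightarrow> complex) \<Rightarrow> bool" where
  "proj_point n p \<longleftrightarrow> (\<exists>i\<le>n. p i \<noteq> 0)"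

text \<open>
  The local ring of projective \<open>n\<close>-space at \<open>p\<close>, inside the fraction field of the polynomial ring:
  quotients of forms of equal degree whose denominator does not vanish at \<open>p\<close>.
\<close>

definition local_ring :: "nat \<Rightarrow> (nat \<Rightarrow> complex) \<Rightarrow> mpoly fract set" where
  "local_ring n p =
     {Fract a b | a b e. a \<in> S_comp n e \<and> b \<in> S_comp n e \<and> eval_at p b \<noteq> 0}"

definition max_ideal :: "nat \<Rightarrow> (nat \<Rightarrow> complex) \<Rightarrow> mpoly fract set" where
  "max_ideal n p =
     {Fract a b | a b e. a \<in> S_comp n e \<and> b \<in> S_comp n e \<and> eval_at p b \<noteq> 0 \<and> eval_at p a = 0}"

definition ideal_product :: "'a::comm_ring_1 set \<Rightarrow> 'a set \<Rightarrow> 'a set" where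
  "ideal_product I J =
     {\<Sum>i<N. a i * b i | (N::nat) a b. \<forall>i<N. a i \<in> I \<and> b i \<in> J}"

primrec max_ideal_power :: "nat \<Rightarrow> (nat \<Rightarrow> complex) \<Rightarrow> nat \<Rightarrow> mpoly fract set" where
  "max_ideal_power n p 0 = local_ring n p"
| "max_ideal_power n p (Suc k) = ideal_product (max_ideal n p) (max_ideal_power n p k)"

text \<open>
  Local equations at \<open>p\<close> of the hypersurface \<open>g = 0\<close> of degree \<open>d\<close>: trivialise by a form of degree
  \<open>d\<close> not vanishing at \<open>p\<close>, for instance \<open>x\<^sub>k\<^sup>d\<close> on the chart \<open>x\<^sub>k \<noteq> 0\<close>.  Any two of them differ by
  a unit of the local ring.
\<close>

definition local_equation ::
    "nat \<Rightarrow> nat \<Rightarrow> mpoly \<Rightarrow> (nat \<Rightarrow> complex) \<Rightarrow> mpoly fract \<Rightarrow> bool" where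
  "local_equation n d g p u \<longleftrightarrow> (\<exists>h\<in>S_comp n d. eval_at p h \<noteq> 0 \<and> u = Fract g h)"

definition has_multiplicity ::
    "nat \<Rightarrow> nat \<Rightarrow> mpoly \<Rightarrow> (nat \<Rightarrow> complex) \<Rightarrow> nat \<Rightarrow> bool" where
  "has_multiplicity n d g p m \<longleftrightarrow>
     (\<exists>u. local_equation n d g p u \<and> u \<in> max_ideal_power n p m \<and> u \<notin> max_ideal_power n p (Suc m))"

definition singularity_of_multiplicity ::
    "nat \<Rightarrow> nat \<Rightarrow> mpoly \<Rightarrow> (nat \<Rightarrow> complex) \<Rightarrow> nat \<Rightarrow> bool" where
  "singularity_of_multiplicity n d g p m \<longleftrightarrow>
     proj_point n p \<and> eval_at p g = 0 \<and> has_multiplicity n d g p m \<and> m \<ge> 2"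

text \<open>
  Homogeneous coordinates: \<open>n + 1\<close> linearly independent linear forms, hence a basis of the
  \<open>(n + 1)\<close>-dimensional space of linear forms.
\<close>

definition linear_coordinates :: "nat \<Rightarrow> (nat \<Rightarrow> mpoly) \<Rightarrow> bool" where
  "linear_coordinates n y \<longleftrightarrow>
     (\<forall>i\<le>n. y i \<in> S_comp n 1) \<and>
     (\<forall>c. (\<Sum>i\<le>n. Const (c i) * y i) = 0 \<longrightarrow> (\<forall>i\<le>n. c i = 0))"

definition sebastiani_thom :: "nat \<Rightarrow> nat \<Rightarrow> mpoly \<Rightarrow> bool" where
  "sebastiani_thom n d f \<longleftrightarrow>
     (\<exists>y l p q. linear_coordinates n y \<and> l < n \<and> p \<in> forms {..l} d \<and> q \<in> forms {l+1..n} d \<and>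
        f = substitute y p + substitute y q)"

end

theory Submission
  imports "Jordan_Normal_Form.Jordan_Normal_Form_Existence" Defs
begin

text \<open>
  Since \<open>g\<close> has no syzygy of degree 2, equality of the tangent spaces forces \<open>\<nabla>f = C \<nabla>g\<close> for a
  constant matrix \<open>C\<close>, which is not scalar by Euler's formula.  Symmetry of the Hessian of \<open>f\<close> says
  that \<open>C\<^sup>T\<close> is self-adjoint for the Hessian of \<open>g\<close>, seen as a symmetric bilinear form with
  polynomial values.  Put \<open>C\<^sup>T\<close> in Jordan normal form.  If there is a Jordan block of size at least
  2, its eigenvector \<open>v\<close> is isotropic, i.e. \<open>\<partial>\<^sub>v\<partial>\<^sub>v g = 0\<close>: then \<open>g\<close> is linear in the direction \<open>v\<close>
  and has multiplicity \<open>d - 1\<close> at the point \<open>v\<close>.  Otherwise \<open>C\<^sup>T\<close> is diagonalisable with at least two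
  eigenvalues, distinct eigenspaces are orthogonal, and \<open>g\<close> splits accordingly.
\<close>

section \<open>Polynomials, evaluation and derivatives\<close>

text \<open>The tangent spaces only give \<open>x\<^sub>k f\<^sub>j\<close> as a combination of the
  \<open>g\<^sub>l\<close> with linear coefficients. Passing to constant coefficients means
  comparing two values of \<open>k\<close>, which costs one more degree; this is where the bound 3
  comes from. The same bound excludes syzygies with constant coefficients, and these would raise the
  multiplicity at \<open>v\<close> above \<open>d - 1\<close>. Isotropy needs the first two vectors
  of a Jordan chain: if \<open>D v = \<lambda> v\<close> and \<open>D u = \<lambda> u + v\<close>,
  then \<open><v, v> = <v, (D - \<lambda>) u> = <(D - \<lambda>) v, u> = 0\<close>. Eigenvectors for
  distinct eigenvalues are orthogonal by the same shift. Both arguments are linear over the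
  constants, so it does no harm that the form has polynomial values. The upper bound on the
  multiplicity is the delicate half, since elements of the local ring are fractions with many
  representations. It needs an invariant that ignores denominators not vanishing at the point: the
  order in \<open>t\<close> after replacing \<open>x\<close> by \<open>p + t x\<close>.\<close>

definition Var :: "nat \<Rightarrow> mpoly" where
  "Var i = Poly_Mapping.single (Poly_Mapping.single i 1) 1"

lemma poly_mapping_eq_sum_single:
  "(\<Sum>m\<in>Poly_Mapping.keys f. Poly_Mapping.single m (Poly_Mapping.lookup f m)) = f"
  by (rule poly_mapping_eqI)
    (simp add: lookup_sum lookup_single when_def sum.delta in_keys_iff)

lemma mpoly_single_induct [case_names single add]:
  fixes f :: mpoly
  assumes single: "\<And>m c. P (Poly_Mapping.single m c)" and add: "\<And>f g. P f \<Longrightarrow> P g \<Longrightarrow> P (f + g)"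
  shows "P f"
proof -
  have "P (\<Sum>m\<in>A. Poly_Mapping.single m (Poly_Mapping.lookup f m))" if "finite A" for A
    \<comment> \<open>The empty sum is reached through \<open>single\<close> with coefficient
      0.\<close>
    using that by induction (use single[of 0 0] in \<open>auto intro: single add\<close>)
  then show ?thesis
    by (metis poly_mapping_eq_sum_single finite_keys)
qed

section \<open>Exponent vectors and induction over them\<close>

lemma mdeg_zero [simp]: "mdeg 0 = 0"
  by (simp add: mdeg_def)

lemma mdeg_single [simp]: "mdeg (Poly_Mapping.single i k) = k"
  by (simp add: mdeg_def)

lemma mdeg_add: "mdeg (m + m') = mdeg m + mdeg m'"
  unfolding mdeg_def by (rule setsum_keys_plus_distrib) auto

lemma mdeg_eq_0_iff [simp]: "mdeg m = 0 \<longleftrightarrow> m = 0"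
  by (auto simp: mdeg_def in_keys_iff intro: poly_mapping_eqI)

lemma keys_add_monom: "Poly_Mapping.keys (m + m' :: monom) = Poly_Mapping.keys m \<union> Poly_Mapping.keys m'"
  by (auto simp: in_keys_iff lookup_add)

text \<open>Subtraction of exponents truncates; the splitting is exact because \<open>i\<close>
  occurs in \<open>m\<close>.\<close>

lemma monom_decompose:
  assumes "i \<in> Poly_Mapping.keys (m :: monom)"
  shows "m = Poly_Mapping.single i 1 + (m - Poly_Mapping.single i 1)"
  using assms by (intro poly_mapping_eqI)
    (auto simp: lookup_add lookup_minus lookup_single when_def in_keys_iff)

lemma monom_induct [consumes 1, case_names zero add]:
  fixes m :: monom
  assumes "Poly_Mapping.keys m \<subseteq> I" and zero: "P 0"
    and add: "\<And>i m. i \<in> I \<Longrightarrow> Poly_Mapping.keys m \<subseteq> I \<Longrightarrow> P m \<Longrightarrow> P (Poly_Mapping.single i 1 + m)"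
  shows "P m"
  using assms(1)
proof (induction "mdeg m" arbitrary: m)
  case 0
  then show ?case using zero by simp
next
  case (Suc k)
  then have "m \<noteq> 0" by auto
  then obtain i where i: "i \<in> Poly_Mapping.keys m"
    by (metis keys_eq_empty ex_in_conv)
  define m' where "m' = m - Poly_Mapping.single i 1"
  have m: "m = Poly_Mapping.single i 1 + m'"
    using monom_decompose[OF i] by (simp add: m'_def)
  have "mdeg m = Suc (mdeg m')" by (subst m) (simp add: mdeg_add)
  moreover have "Poly_Mapping.keys m' \<subseteq> I"
    using Suc.prems by (subst (asm) m) (simp add: keys_add_monom)
  moreover have "i \<in> I" using i Suc.prems by auto
  ultimately show ?case using add Suc.hyps by (metis m diff_Suc_1)
qed

lemma single_eq_Const_mult: "Poly_Mapping.single m c = Const c * Poly_Mapping.single m 1"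
  by (simp add: Const_def mult_single)

lemma polys_add: "f \<in> polys I \<Longrightarrow> g \<in> polys I \<Longrightarrow> f + g \<in> polys I"
  using keys_add[of f g] by (auto simp: polys_def)

text \<open>Unlike the induction over single terms, the step multiplies by one variable of
  \<open>I\<close> at a time, which fits the Leibniz and chain rules.\<close>

lemma polys_induct [consumes 1, case_names Const add Var]:
  assumes f: "f \<in> polys I" and Const: "\<And>c. P (Const c)"
    and add: "\<And>f g. P f \<Longrightarrow> P g \<Longrightarrow> P (f + g)"
    and Var: "\<And>i f. i \<in> I \<Longrightarrow> f \<in> polys I \<Longrightarrow> P f \<Longrightarrow> P (Var i * f)"
  shows "P f"
proof -
  have "Poly_Mapping.single m c \<in> polys I \<and> P (Poly_Mapping.single m c)"
    if "Poly_Mapping.keys m \<subseteq> I" for m c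
    using that
  proof (induction m rule: monom_induct)
    case zero
    then show ?case using Const[of c] by (simp add: Const_def polys_def)
  next
    case (add i m)
    have *: "Poly_Mapping.single (Poly_Mapping.single i 1 + m) c = Var i * Poly_Mapping.single m c"
      by (simp add: Var_def mult_single)
    have "Poly_Mapping.single (Poly_Mapping.single i 1 + m) c \<in> polys I"
      using add by (auto simp: polys_def keys_add_monom)
    then show ?case
      unfolding * using Var add by blast
  qed
  then have "P (Poly_Mapping.single m (Poly_Mapping.lookup f m))" if "m \<in> Poly_Mapping.keys f" for m
    using f that by (auto simp: polys_def)
  moreover have "P (sum h A)" if "finite A" "\<And>m. m \<in> A \<Longrightarrow> P (h m)" for h :: "monom \<Rightarrow> mpoly" and A
    using that by induction (use Const[of 0] add in \<open>auto simp: Const_def\<close>)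
  ultimately show ?thesis
    by (metis (no_types, lifting) poly_mapping_eq_sum_single finite_keys)
qed

interpretation Const: comm_ring_hom Const
  by unfold_locales (auto simp: Const_def single_add mult_single)

lemma Const_eq_0_iff [simp]: "Const c = 0 \<longleftrightarrow> c = 0"
  by (metis Const_def lookup_single_eq lookup_zero single_zero)

lemma Const_eq_iff [simp]: "Const a = Const b \<longleftrightarrow> a = b"
  by (metis Const_def lookup_single_eq)

section \<open>Evaluation and substitution as ring homomorphisms\<close>

definition monom_eval :: "(nat \<Rightarrow> 'b::comm_semiring_1) \<Rightarrow> monom \<Rightarrow> 'b" where
  "monom_eval v m = (\<Prod>i\<in>Poly_Mapping.keys m. v i ^ Poly_Mapping.lookup m i)"

lemma mp_eval_altdef:
  "mp_eval \<phi> v f = (\<Sum>m\<in>Poly_Mapping.keys f. \<phi> (Poly_Mapping.lookup f m) * monom_eval v m)"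
  by (simp add: mp_eval_def monom_eval_def)

lemma monom_eval_0 [simp]: "monom_eval v 0 = 1"
  by (simp add: monom_eval_def)

lemma monom_eval_single [simp]: "monom_eval v (Poly_Mapping.single i k) = v i ^ k"
  by (simp add: monom_eval_def)

lemma monom_eval_superset:
  "finite A \<Longrightarrow> Poly_Mapping.keys m \<subseteq> A \<Longrightarrow> monom_eval v m = (\<Prod>i\<in>A. v i ^ Poly_Mapping.lookup m i)"
  unfolding monom_eval_def by (rule prod.mono_neutral_left) (auto simp: in_keys_iff)

lemma monom_eval_add: "monom_eval v (m + m') = monom_eval v m * monom_eval v m'"
proof -
  let ?A = "Poly_Mapping.keys m \<union> Poly_Mapping.keys m'"
  have "monom_eval v (m + m') = (\<Prod>i\<in>?A. v i ^ Poly_Mapping.lookup (m + m') i)"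
    by (rule monom_eval_superset) (auto simp: keys_add_monom)
  also have "\<dots> = (\<Prod>i\<in>?A. v i ^ Poly_Mapping.lookup m i) * (\<Prod>i\<in>?A. v i ^ Poly_Mapping.lookup m' i)"
    by (simp add: lookup_add power_add prod.distrib)
  also have "\<dots> = monom_eval v m * monom_eval v m'"
    by (simp add: monom_eval_superset[of ?A])
  finally show ?thesis .
qed

lemma monom_eval_scale: "monom_eval (\<lambda>i. t * v i) m = t ^ mdeg m * monom_eval v m"
  by (simp add: monom_eval_def mdeg_def power_mult_distrib prod.distrib power_sum)

context
  fixes \<phi> :: "complex \<Rightarrow> 'b::comm_ring_1"
  assumes hom: "comm_ring_hom \<phi>"
begin

interpretation \<phi>: comm_ring_hom \<phi> by (fact hom)

lemma mp_eval_single: "mp_eval \<phi> v (Poly_Mapping.single m c) = \<phi> c * monom_eval v m"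
  by (simp add: mp_eval_altdef)

lemma mp_eval_Const: "mp_eval \<phi> v (Const c) = \<phi> c"
  by (simp add: Const_def mp_eval_single)

lemma mp_eval_Var: "mp_eval \<phi> v (Var i) = v i"
  by (simp add: Var_def mp_eval_single)

lemma mp_eval_add: "mp_eval \<phi> v (f + g) = mp_eval \<phi> v f + mp_eval \<phi> v g"
  unfolding mp_eval_altdef
  by (rule setsum_keys_plus_distrib) (auto simp: \<phi>.hom_add algebra_simps)

lemma mp_eval_mult: "mp_eval \<phi> v (f * g) = mp_eval \<phi> v f * mp_eval \<phi> v g"
proof (induction f rule: mpoly_single_induct)
  case (single m c)
  show ?case
    by (induction g rule: mpoly_single_induct)
      (simp_all add: mult_single mp_eval_single mp_eval_add monom_eval_add \<phi>.hom_mult algebra_simps)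
qed (simp add: mp_eval_add algebra_simps)

lemma comm_ring_hom_mp_eval: "comm_ring_hom (mp_eval \<phi> v)"
proof
  show "mp_eval \<phi> v 1 = 1"
    using mp_eval_Const[of v 1] by (simp add: Const_def)
  show "mp_eval \<phi> v 0 = 0"
    by (simp add: mp_eval_def)
qed (rule mp_eval_add mp_eval_mult)+

end

interpretation subst: comm_ring_hom "substitute y" for y
  by (rule comm_ring_hom_mp_eval) (rule Const.comm_ring_hom_axioms)

lemmas substitute_Const = mp_eval_Const[OF Const.comm_ring_hom_axioms]
lemmas substitute_Var = mp_eval_Var[OF Const.comm_ring_hom_axioms]

lemma hom_monom_eval: "comm_ring_hom \<psi> \<Longrightarrow> \<psi> (monom_eval v m) = monom_eval (\<lambda>i. \<psi> (v i)) m"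
proof -
  assume "comm_ring_hom \<psi>"
  then interpret comm_ring_hom \<psi> .
  show ?thesis by (simp add: monom_eval_def hom_prod hom_power)
qed

lemma hom_mp_eval: "comm_ring_hom \<psi> \<Longrightarrow> \<psi> (mp_eval \<phi> v f) = mp_eval (\<lambda>c. \<psi> (\<phi> c)) (\<lambda>i. \<psi> (v i)) f"
proof -
  assume *: "comm_ring_hom \<psi>"
  then interpret comm_ring_hom \<psi> .
  show ?thesis by (simp add: mp_eval_altdef hom_sum hom_mult hom_monom_eval[OF *])
qed

lemma mp_eval_cong:
  "f \<in> polys I \<Longrightarrow> (\<And>i. i \<in> I \<Longrightarrow> v i = v' i) \<Longrightarrow> mp_eval \<phi> v f = mp_eval \<phi> v' f"
  unfolding mp_eval_def polys_def
  by (intro sum.cong prod.cong arg_cong2[of _ _ _ _ "(*)"]) (auto dest!: bspec subsetD)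

lemma monom_eval_Var: "monom_eval Var m = Poly_Mapping.single m 1"
  using subset_UNIV
proof (induction m rule: monom_induct)
  case (add i m)
  then show ?case
    by (simp add: monom_eval_add Var_def mult_single)
qed simp

lemma substitute_Var_id: "substitute Var f = f"
  unfolding mp_eval_altdef monom_eval_Var single_eq_Const_mult[symmetric]
  by (rule poly_mapping_eq_sum_single)

text \<open>Serves twice: with \<open>t = 0\<close> it makes forms of positive degree vanish where
  all their arguments do, and with \<open>t\<close> a polynomial variable it extracts a power of
  that variable.\<close>

lemma mp_eval_scale:
  assumes "f \<in> forms I e"
  shows "mp_eval \<phi> (\<lambda>i. t * v i) f = t ^ e * mp_eval \<phi> v f"
  unfolding mp_eval_altdef sum_distrib_left
  using assms by (intro sum.cong) (auto simp: monom_eval_scale forms_def mult_ac)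

section \<open>Closure properties of the graded pieces\<close>

lemma forms_polys: "f \<in> forms I d \<Longrightarrow> f \<in> polys I"
  by (simp add: forms_def)

lemma forms_mono: "f \<in> forms I d \<Longrightarrow> I \<subseteq> J \<Longrightarrow> f \<in> forms J d"
  by (auto simp: forms_def polys_def)

lemma forms_0 [simp]: "0 \<in> forms I d"
  by (simp add: forms_def polys_def)

lemma forms_add: "f \<in> forms I d \<Longrightarrow> g \<in> forms I d \<Longrightarrow> f + g \<in> forms I d"
  using keys_add[of f g] by (fastforce simp: forms_def polys_def)

lemma forms_sum: "(\<And>i. i \<in> A \<Longrightarrow> f i \<in> forms I d) \<Longrightarrow> sum f A \<in> forms I d"
  by (induction A rule: infinite_finite_induct) (auto intro: forms_add)

lemma forms_mult: "f \<in> forms I d \<Longrightarrow> g \<in> forms I e \<Longrightarrow> f * g \<in> forms I (d + e)"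
  using keys_mult[of f g]
  by (fastforce simp: forms_def polys_def mdeg_add keys_add_monom)

lemma forms_Const: "Const c \<in> forms I 0"
  by (auto simp: forms_def polys_def Const_def)

lemma forms_1: "1 \<in> forms I 0"
  using forms_Const[of 1] by simp

lemma forms_Const_mult: "f \<in> forms I d \<Longrightarrow> Const c * f \<in> forms I d"
  using forms_mult[OF forms_Const] by fastforce

lemma forms_diff: "f \<in> forms I d \<Longrightarrow> g \<in> forms I d \<Longrightarrow> f - g \<in> forms I d"
  using forms_add[of f I d "Const (-1) * g"] forms_Const_mult[of g I d "-1"]
  by (simp add: Const.hom_uminus)

lemma forms_Var: "i \<in> I \<Longrightarrow> Var i \<in> forms I 1"
  by (auto simp: forms_def polys_def Var_def)

lemma forms_power: "f \<in> forms I d \<Longrightarrow> f ^ k \<in> forms I (k * d)"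
  by (induction k) (auto intro: forms_1 forms_mult)

lemma forms_monom_eval:
  "Poly_Mapping.keys m \<subseteq> I \<Longrightarrow> (\<And>i. i \<in> I \<Longrightarrow> v i \<in> forms J 1) \<Longrightarrow> monom_eval v m \<in> forms J (mdeg m)"
  by (induction m rule: monom_induct)
    (auto simp: monom_eval_add mdeg_add intro: forms_1 forms_mult[of _ _ 1, simplified])

lemma forms_substitute:
  assumes f: "f \<in> forms I d" and v: "\<And>i. i \<in> I \<Longrightarrow> v i \<in> forms J 1"
  shows "substitute v f \<in> forms J d"
  unfolding mp_eval_altdef
proof (intro forms_sum forms_Const_mult)
  fix m assume "m \<in> Poly_Mapping.keys f"
  then have "Poly_Mapping.keys m \<subseteq> I" "mdeg m = d"
    using f by (auto simp: forms_def polys_def)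
  then show "monom_eval v m \<in> forms J d" using forms_monom_eval[of m I v J] v by auto
qed

text \<open>Only the exponent one step above \<open>m\<close> in direction \<open>i\<close>
  contributes: a term without \<open>x\<^sub>i\<close> keeps its exponent under truncated
  subtraction, but gets coefficient 0. This closed form reduces later identities to comparing
  coefficients.\<close>

lemma lookup_partial:
  "Poly_Mapping.lookup (partial i f) m =
     of_nat (Suc (Poly_Mapping.lookup m i)) * Poly_Mapping.lookup f (m + Poly_Mapping.single i 1)"
proof -
  have "Poly_Mapping.lookup (Poly_Mapping.single (m' - Poly_Mapping.single i 1)
          (of_nat (Poly_Mapping.lookup m' i) * Poly_Mapping.lookup f m')) m =
        (if m' = m + Poly_Mapping.single i 1
         then of_nat (Suc (Poly_Mapping.lookup m i)) * Poly_Mapping.lookup f m' else 0)" for m'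
  proof (cases "i \<in> Poly_Mapping.keys m'")
    case True
    from monom_decompose[OF this] have "m' - Poly_Mapping.single i 1 = m \<longleftrightarrow> m' = m + Poly_Mapping.single i 1"
      by (metis add.commute add_diff_cancel_left')
    then show ?thesis
      by (auto simp: lookup_single when_def lookup_add)
  next
    case False
    then have "m' \<noteq> m + Poly_Mapping.single i 1" by (auto simp: keys_add_monom)
    with False show ?thesis by (simp add: in_keys_iff)
  qed
  then show ?thesis
    by (simp add: partial_def lookup_sum sum.delta in_keys_iff)
qed

lemma partial_single:
  "partial i (Poly_Mapping.single m c) =
     Poly_Mapping.single (m - Poly_Mapping.single i 1) (of_nat (Poly_Mapping.lookup m i) * c)"
  by (simp add: partial_def)

lemma partial_add: "partial i (f + g) = partial i f + partial i g"
  by (rule poly_mapping_eqI) (simp add: lookup_partial lookup_add algebra_simps)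

lemma partial_0 [simp]: "partial i 0 = 0"
  by (simp add: partial_def)

lemma partial_commute: "partial i (partial j f) = partial j (partial i f)"
  by (rule poly_mapping_eqI)
    (auto simp: lookup_partial lookup_add lookup_single when_def add_ac)

lemma partial_Const [simp]: "partial i (Const c) = 0"
  by (simp add: Const_def partial_single)

lemma partial_Var: "partial i (Var j) = (if i = j then 1 else 0)"
  by (simp add: Var_def partial_single lookup_single when_def)

lemma partial_mult: "partial i (f * g) = partial i f * g + f * partial i g"
proof (induction f rule: mpoly_single_induct)
  case (single m c)
  show ?case
  proof (induction g rule: mpoly_single_induct)
    case (single m' c')
    \<comment> \<open>If \<open>i\<close> does not occur in \<open>m\<close>, the two exponents may
      differ, but both coefficients are 0.\<close>
    have *: "Poly_Mapping.single (m + m' - Poly_Mapping.single i 1) (of_nat (Poly_Mapping.lookup m i) * x) =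
        Poly_Mapping.single (m - Poly_Mapping.single i 1 + m') (of_nat (Poly_Mapping.lookup m i) * x)"
      for m m' and x :: complex
    proof (cases "i \<in> Poly_Mapping.keys m")
      case True
      from monom_decompose[OF this] have "m + m' - Poly_Mapping.single i 1 = m - Poly_Mapping.single i 1 + m'"
        by (metis add.assoc add_diff_cancel_left')
      then show ?thesis by simp
    qed (simp add: in_keys_iff)
    show ?case
      using *[of m m' "c * c'"] *[of m' m "c * c'"]
      by (simp add: mult_single partial_single lookup_add algebra_simps single_add)
  qed (simp add: partial_add algebra_simps)
qed (simp add: partial_add algebra_simps)

lemma partial_Const_mult: "partial i (Const c * f) = Const c * partial i f"
  by (simp add: partial_mult)

lemma partial_sum: "partial i (sum f A) = (\<Sum>a\<in>A. partial i (f a))"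
  by (induction A rule: infinite_finite_induct) (auto simp: partial_add)

lemma forms_partial:
  assumes "f \<in> forms I (Suc d)"
  shows "partial i f \<in> forms I d"
proof -
  have "Poly_Mapping.keys m \<subseteq> I \<and> mdeg m = d" if "m \<in> Poly_Mapping.keys (partial i f)" for m
  proof -
    from that have "m + Poly_Mapping.single i 1 \<in> Poly_Mapping.keys f"
      by (auto simp: in_keys_iff lookup_partial)
    then have "Poly_Mapping.keys (m + Poly_Mapping.single i 1) \<subseteq> I" "mdeg (m + Poly_Mapping.single i 1) = Suc d"
      using assms by (auto simp: forms_def polys_def)
    then show ?thesis by (simp add: keys_add_monom mdeg_add)
  qed
  then show ?thesis by (auto simp: forms_def polys_def)
qed

lemma polys_partial: "f \<in> polys I \<Longrightarrow> partial i f \<in> polys I"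
proof (induction f rule: polys_induct)
  case (Var j f)
  have "Var j * g \<in> polys I" if "g \<in> polys I" for g
    using that keys_mult[of "Var j" g] \<open>j \<in> I\<close> by (fastforce simp: polys_def Var_def keys_add_monom)
  then show ?case using Var by (auto simp: partial_mult partial_Var intro: polys_add)
qed (auto simp: partial_add intro: polys_add, simp add: polys_def)

text \<open>In characteristic 0, a monomial containing \<open>x\<^sub>i\<close> leaves a nonzero
  coefficient in the derivative, and no other monomial contributes to the same place.\<close>

lemma partial_eq_0_forms:
  assumes "f \<in> forms I d" and "partial i f = 0"
  shows "f \<in> forms (I - {i}) d"
proof -
  have "i \<notin> Poly_Mapping.keys m" if m: "m \<in> Poly_Mapping.keys f" for m
  proof
    assume "i \<in> Poly_Mapping.keys m"
    from monom_decompose[OF this] have *: "(m - Poly_Mapping.single i 1) + Poly_Mapping.single i 1 = m"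
      by (simp add: add.commute)
    have "Poly_Mapping.lookup (partial i f) (m - Poly_Mapping.single i 1) \<noteq> 0"
      unfolding lookup_partial * using m by (simp add: in_keys_iff del: of_nat_Suc)
    with assms show False by simp
  qed
  then show ?thesis using assms by (auto simp: forms_def polys_def)
qed

text \<open>Each monomial is an eigenvector of multiplying by \<open>x\<^sub>i\<close> after
  differentiating along it, with eigenvalue its exponent at \<open>i\<close>; the exponents add up
  to \<open>d\<close>.\<close>

lemma euler_identity:
  assumes "f \<in> forms I d" "finite I"
  shows "(\<Sum>i\<in>I. Var i * partial i f) = of_nat d * f"
proof -
  have "Var i * partial i f = (\<Sum>m\<in>Poly_Mapping.keys f.
      Poly_Mapping.single m (of_nat (Poly_Mapping.lookup m i) * Poly_Mapping.lookup f m))" for i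
    unfolding partial_def sum_distrib_left
  proof (rule sum.cong[OF refl])
    fix m
    show "Var i * Poly_Mapping.single (m - Poly_Mapping.single i 1)
        (of_nat (Poly_Mapping.lookup m i) * Poly_Mapping.lookup f m) =
      Poly_Mapping.single m (of_nat (Poly_Mapping.lookup m i) * Poly_Mapping.lookup f m)"
    proof (cases "i \<in> Poly_Mapping.keys m")
      case True
      from monom_decompose[OF this] show ?thesis by (simp add: Var_def mult_single)
    qed (simp add: in_keys_iff)
  qed
  then have "(\<Sum>i\<in>I. Var i * partial i f) = (\<Sum>m\<in>Poly_Mapping.keys f. \<Sum>i\<in>I.
      Poly_Mapping.single m (of_nat (Poly_Mapping.lookup m i) * Poly_Mapping.lookup f m))"
    by (simp add: sum.swap[of _ I])
  also have "\<dots> = (\<Sum>m\<in>Poly_Mapping.keys f. of_nat d * Poly_Mapping.single m (Poly_Mapping.lookup f m))"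
  proof (rule sum.cong[OF refl])
    fix m assume "m \<in> Poly_Mapping.keys f"
    then have m: "Poly_Mapping.keys m \<subseteq> I" "mdeg m = d"
      using assms by (auto simp: forms_def polys_def)
    have "d = (\<Sum>i\<in>I. Poly_Mapping.lookup m i)"
      unfolding m(2)[symmetric] mdeg_def using m assms
      by (intro sum.mono_neutral_left) (auto simp: in_keys_iff)
    then have "of_nat d * Poly_Mapping.single m (Poly_Mapping.lookup f m) =
        Poly_Mapping.single m ((\<Sum>i\<in>I. of_nat (Poly_Mapping.lookup m i)) * Poly_Mapping.lookup f m)"
      by (simp add: single_of_nat[symmetric] mult_single del: single_of_nat)
    also have "\<dots> = (\<Sum>i\<in>I. Poly_Mapping.single m (of_nat (Poly_Mapping.lookup m i) * Poly_Mapping.lookup f m))"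
      by (rule poly_mapping_eqI) (simp add: lookup_sum lookup_single when_def sum_distrib_right)
    finally show "(\<Sum>i\<in>I. Poly_Mapping.single m (of_nat (Poly_Mapping.lookup m i) * Poly_Mapping.lookup f m)) =
      of_nat d * Poly_Mapping.single m (Poly_Mapping.lookup f m)" by simp
  qed
  also have "\<dots> = of_nat d * f"
    by (simp add: sum_distrib_left[symmetric] poly_mapping_eq_sum_single)
  finally show ?thesis .
qed

lemma partial_substitute:
  assumes "f \<in> polys I" "finite I"
  shows "partial i (substitute y f) = (\<Sum>j\<in>I. substitute y (partial j f) * partial i (y j))"
  using assms(1)
proof (induction f rule: polys_induct)
  case (Var k f)
  have "(\<Sum>j\<in>I. substitute y (partial j (Var k * f)) * partial i (y j)) =
     (\<Sum>j\<in>I. (if k = j then substitute y f * partial i (y j) else 0) + y k * (substitute y (partial j f) * partial i (y j)))"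
    by (intro sum.cong) (auto simp: partial_mult partial_Var subst.hom_add subst.hom_mult substitute_Var algebra_simps)
  also have "\<dots> = partial i (substitute y (Var k * f))"
    using Var assms(2)
    by (simp add: sum.distrib sum.delta sum_distrib_left[symmetric] partial_mult subst.hom_mult substitute_Var mult_ac)
  finally show ?case by simp
qed (auto simp: substitute_Const partial_add subst.hom_add sum.distrib algebra_simps)

section \<open>Multiplicity of a point\<close>

lemma forms_0_eq_Const:
  assumes "f \<in> forms I 0"
  shows "f = Const (Poly_Mapping.lookup f 0)"
proof (rule poly_mapping_eqI)
  fix m show "Poly_Mapping.lookup f m = Poly_Mapping.lookup (Const (Poly_Mapping.lookup f 0)) m"
    using assms by (cases "m = 0") (auto simp: Const_def lookup_single forms_def in_keys_iff)
qed

text \<open>Euler's identity in degree 1, where the partial derivatives are constants.\<close>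

lemma linear_form_eq_sum:
  assumes "f \<in> forms I 1" "finite I"
  obtains c where "f = (\<Sum>i\<in>I. Const (c i) * Var i)"
proof -
  have "partial i f = Const (Poly_Mapping.lookup (partial i f) 0)" for i
    using forms_partial[of f I 0] assms by (intro forms_0_eq_Const) simp
  then have "f = (\<Sum>i\<in>I. Const (Poly_Mapping.lookup (partial i f) 0) * Var i)"
    using euler_identity[OF assms] by (simp add: mult.commute)
  then show thesis by (rule that)
qed

lemma comm_ring_hom_ident: "comm_ring_hom (\<lambda>c. c)"
  by unfold_locales auto

interpretation eval: comm_ring_hom "eval_at p" for p
  by (rule comm_ring_hom_mp_eval[OF comm_ring_hom_ident])

lemma eval_at_Const [simp]: "eval_at p (Const c) = c"
  by (rule mp_eval_Const[OF comm_ring_hom_ident])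

lemma eval_at_Var [simp]: "eval_at p (Var i) = p i"
  by (rule mp_eval_Var[OF comm_ring_hom_ident])

section \<open>Membership in powers of the maximal ideal of a point\<close>

lemma ideal_product_0: "0 \<in> ideal_product I J"
  unfolding ideal_product_def by (auto intro!: exI[of _ 0])

lemma ideal_product_add_mult:
  assumes "x \<in> ideal_product I J" "u \<in> I" "v \<in> J"
  shows "x + u * v \<in> ideal_product I J"
proof -
  from assms(1) obtain N a b where x: "x = (\<Sum>i<(N::nat). a i * b i)"
    and ab: "\<forall>i<N. a i \<in> I \<and> b i \<in> J"
    unfolding ideal_product_def by blast
  have "x + u * v = (\<Sum>i<Suc N. (a(N := u)) i * (b(N := v)) i)"
    by (simp add: x)
  moreover have "\<forall>i<Suc N. (a(N := u)) i \<in> I \<and> (b(N := v)) i \<in> J"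
    using ab assms by (auto simp: less_Suc_eq)
  ultimately show ?thesis unfolding ideal_product_def by blast
qed

lemma ideal_product_induct [consumes 1, case_names zero add]:
  assumes "x \<in> ideal_product I J" and zero: "P 0"
    and add: "\<And>x u v. P x \<Longrightarrow> u \<in> I \<Longrightarrow> v \<in> J \<Longrightarrow> P (x + u * v)"
  shows "P x"
proof -
  from assms(1) obtain N a b where x: "x = (\<Sum>i<(N::nat). a i * b i)"
    and ab: "\<forall>i<N. a i \<in> I \<and> b i \<in> J"
    unfolding ideal_product_def by blast
  have "P (\<Sum>i<k. a i * b i)" if "k \<le> N" for k
    using that by (induction k) (use ab zero in \<open>auto intro: add\<close>)
  then show ?thesis using x by simp
qed

lemma ideal_product_mult: "u \<in> I \<Longrightarrow> v \<in> J \<Longrightarrow> u * v \<in> ideal_product I J"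
  using ideal_product_add_mult[OF ideal_product_0] by fastforce

lemma ideal_product_add:
  assumes "x \<in> ideal_product I J" "y \<in> ideal_product I J"
  shows "x + y \<in> ideal_product I J"
  using assms(2)
proof (induction rule: ideal_product_induct)
  case (add z u v)
  then show ?case using ideal_product_add_mult[of "x + z"] by (simp add: add.assoc)
qed (use assms(1) in simp)

lemma local_ring_0: "0 \<in> local_ring n p"
  unfolding local_ring_def Zero_fract_def
  by (intro CollectI exI[of _ 0] exI[of _ 1] conjI) (auto intro: forms_1)

lemma local_ring_add:
  assumes "x \<in> local_ring n p" "y \<in> local_ring n p"
  shows "x + y \<in> local_ring n p"
proof -
  obtain a b e where x: "x = Fract a b" "a \<in> S_comp n e" "b \<in> S_comp n e" "eval_at p b \<noteq> 0"
    using assms(1) by (auto simp: local_ring_def)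
  obtain a' b' e' where y: "y = Fract a' b'" "a' \<in> S_comp n e'" "b' \<in> S_comp n e'" "eval_at p b' \<noteq> 0"
    using assms(2) by (auto simp: local_ring_def)
  have nz: "b \<noteq> 0" "b' \<noteq> 0" using x(4) y(4) by auto
  have "x + y = Fract (a * b' + a' * b) (b * b')" using x(1) y(1) nz by simp
  moreover have "a * b' + a' * b \<in> S_comp n (e + e')" "b * b' \<in> S_comp n (e + e')"
    using forms_mult[OF x(2) y(3)] forms_mult[OF y(2) x(3)] forms_mult[OF x(3) y(3)]
    by (auto simp: add.commute intro: forms_add)
  moreover have "eval_at p (b * b') \<noteq> 0" using x(4) y(4) by (simp add: eval.hom_mult)
  ultimately show ?thesis unfolding local_ring_def by blast
qed

lemma max_ideal_power_0: "0 \<in> max_ideal_power n p k"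
  by (cases k) (auto intro: local_ring_0 ideal_product_0)

lemma max_ideal_power_add:
  "x \<in> max_ideal_power n p k \<Longrightarrow> y \<in> max_ideal_power n p k \<Longrightarrow> x + y \<in> max_ideal_power n p k"
  by (cases k) (auto intro: local_ring_add ideal_product_add)

lemma Fract_add: "b \<noteq> 0 \<Longrightarrow> Fract (x + y) b = Fract x b + Fract y b"
  by (simp add: eq_fract algebra_simps)

lemma Fract_sum: "b \<noteq> 0 \<Longrightarrow> Fract (sum f A) b = (\<Sum>i\<in>A. Fract (f i) b)"
  by (induction A rule: infinite_finite_induct) (auto simp: Fract_add fract_collapse)

context
  fixes n :: nat and p :: "nat \<Rightarrow> complex" and h :: mpoly and v :: "nat \<Rightarrow> mpoly" and I :: "nat set"
  assumes h: "h \<in> S_comp n 1" "eval_at p h \<noteq> 0"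
    and v: "\<And>i. i \<in> I \<Longrightarrow> v i \<in> S_comp n 1" "\<And>i. i \<in> I \<Longrightarrow> eval_at p (v i) = 0"
begin

text \<open>Each \<open>Fract (v i) h\<close> lies in the maximal ideal, so one linear factor is
  split off per power. The factors left over form a quotient of forms of equal degree, which stays
  in the local ring.\<close>

lemma Fract_monom_in_max_ideal_power:
  assumes "Poly_Mapping.keys m \<subseteq> I" "k \<le> mdeg m"
  shows "Fract (Const c * monom_eval v m) (h ^ mdeg m) \<in> max_ideal_power n p k"
  using assms
proof (induction k arbitrary: m)
  case 0
  have "Const c * monom_eval v m \<in> S_comp n (mdeg m)"
    using forms_monom_eval[OF 0(1), of v "{..n}"] v(1) by (intro forms_Const_mult) auto
  moreover have "h ^ mdeg m \<in> S_comp n (mdeg m)" "eval_at p (h ^ mdeg m) \<noteq> 0"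
    using forms_power[OF h(1), of "mdeg m"] h(2) by (auto simp: eval.hom_power)
  ultimately show ?case by (auto simp: local_ring_def)
next
  case (Suc k)
  then have "m \<noteq> 0" by auto
  then obtain i where i: "i \<in> Poly_Mapping.keys m"
    by (metis keys_eq_empty ex_in_conv)
  define m' where "m' = m - Poly_Mapping.single i 1"
  have m: "m = Poly_Mapping.single i 1 + m'"
    using monom_decompose[OF i] by (simp add: m'_def)
  have iI: "i \<in> I" using i Suc.prems by auto
  have "mdeg m = Suc (mdeg m')" "Poly_Mapping.keys m' \<subseteq> I"
    using Suc.prems(1) by (auto simp: m mdeg_add keys_add_monom)
  then have "Fract (Const c * monom_eval v m) (h ^ mdeg m) =
      Fract (v i) h * Fract (Const c * monom_eval v m') (h ^ mdeg m')"
    by (simp add: m monom_eval_add mult_ac mdeg_add)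
  moreover have "Fract (v i) h \<in> max_ideal n p"
    unfolding max_ideal_def using h v iI by blast
  moreover have "Fract (Const c * monom_eval v m') (h ^ mdeg m') \<in> max_ideal_power n p k"
    using Suc \<open>mdeg m = Suc (mdeg m')\<close> \<open>Poly_Mapping.keys m' \<subseteq> I\<close> by simp
  ultimately show ?case by (simp only: max_ideal_power.simps ideal_product_mult)
qed

lemma Fract_substitute_in_max_ideal_power:
  assumes "f \<in> forms I e" "k \<le> e"
  shows "Fract (substitute v f) (h ^ e) \<in> max_ideal_power n p k"
proof -
  have "h ^ e \<noteq> 0" using h(2) by auto
  then have "Fract (substitute v f) (h ^ e) = (\<Sum>m\<in>Poly_Mapping.keys f.
      Fract (Const (Poly_Mapping.lookup f m) * monom_eval v m) (h ^ e))"
    by (simp add: mp_eval_altdef Fract_sum)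
  moreover have "Fract (Const (Poly_Mapping.lookup f m) * monom_eval v m) (h ^ e) \<in> max_ideal_power n p k"
    if "m \<in> Poly_Mapping.keys f" for m
  proof -
    have "Poly_Mapping.keys m \<subseteq> I" "mdeg m = e" using that assms by (auto simp: forms_def polys_def)
    then show ?thesis using Fract_monom_in_max_ideal_power[of m k] assms by simp
  qed
  moreover have "sum x A \<in> max_ideal_power n p k" if "\<And>i. i \<in> A \<Longrightarrow> x i \<in> max_ideal_power n p k"
    for x and A :: "monom set"
    using that by (induction A rule: infinite_finite_induct)
      (auto intro: max_ideal_power_0 max_ideal_power_add)
  ultimately show ?thesis by simp
qed

end

text \<open>
  The expansion of \<open>f (p + t x)\<close> as a polynomial in \<open>t\<close>; its order in \<open>t\<close> is the order of vanishing
  of \<open>f\<close> at the point \<open>p\<close> of affine space.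
\<close>

definition expand :: "(nat \<Rightarrow> complex) \<Rightarrow> mpoly \<Rightarrow> mpoly poly" where
  "expand p = mp_eval (\<lambda>c. [:Const c:]) (\<lambda>i. [:Const (p i), Var i:])"

lemma comm_ring_hom_pCons_0: "comm_ring_hom (\<lambda>c. [:c::mpoly:])"
  by unfold_locales (auto simp: one_pCons)

lemma comm_ring_hom_Const_poly: "comm_ring_hom (\<lambda>c. [:Const c:])"
  by unfold_locales (auto simp: one_pCons Const.hom_add Const.hom_mult)

interpretation expand: comm_ring_hom "expand p" for p
  unfolding expand_def by (rule comm_ring_hom_mp_eval[OF comm_ring_hom_Const_poly])

lemma expand_Const: "expand p (Const c) = [:Const c:]"
  by (simp add: expand_def mp_eval_Const[OF comm_ring_hom_Const_poly])

lemma expand_Var: "expand p (Var i) = [:Const (p i), Var i:]"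
  by (simp add: expand_def mp_eval_Var[OF comm_ring_hom_Const_poly])

lemma poly_expand_0: "poly (expand p f) 0 = Const (eval_at p f)"
proof -
  have "comm_ring_hom (\<lambda>q. poly q (0::mpoly))" by unfold_locales auto
  from hom_mp_eval[OF this] have "poly (expand p f) 0 = mp_eval Const (\<lambda>i. Const (p i)) f"
    by (simp add: expand_def)
  also have "\<dots> = Const (eval_at p f)"
    by (simp add: hom_mp_eval[OF Const.comm_ring_hom_axioms])
  finally show ?thesis .
qed

lemma expand_linear:
  assumes "f \<in> forms I 1" "finite I"
  shows "expand p f = [:Const (eval_at p f), f:]"
proof -
  obtain c where c: "f = (\<Sum>i\<in>I. Const (c i) * Var i)" using linear_form_eq_sum[OF assms] .
  have "expand p (\<Sum>i\<in>J. Const (c i) * Var i) =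
      [:Const (eval_at p (\<Sum>i\<in>J. Const (c i) * Var i)), \<Sum>i\<in>J. Const (c i) * Var i:]" for J
    by (induction J rule: infinite_finite_induct)
      (auto simp: expand.hom_add expand.hom_mult eval.hom_add eval.hom_mult Const.hom_add
        Const.hom_mult expand_Const expand_Var)
  then show ?thesis by (simp add: c)
qed

text \<open>A linear form vanishing at \<open>p\<close> takes the value
  \<open>t v\<^sub>i(x)\<close> at \<open>p + t x\<close>, and homogeneity of \<open>f\<close>
  collects the factors \<open>t\<close>.\<close>

lemma expand_substitute:
  assumes f: "f \<in> forms I e" and v: "\<And>i. i \<in> I \<Longrightarrow> v i \<in> S_comp n 1"
    "\<And>i. i \<in> I \<Longrightarrow> eval_at p (v i) = 0"
  shows "expand p (substitute v f) = [:0, 1:] ^ e * [:substitute v f:]"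
proof -
  have "expand p (substitute v f) = mp_eval (\<lambda>c. [:Const c:]) (\<lambda>i. expand p (v i)) f"
    by (simp add: hom_mp_eval[OF expand.comm_ring_hom_axioms] expand_Const)
  also have "\<dots> = mp_eval (\<lambda>c. [:Const c:]) (\<lambda>i. [:0, 1:] * [:v i:]) f"
    using v by (intro mp_eval_cong[OF forms_polys[OF f]])
      (simp add: expand_linear[OF v(1) finite_atMost])
  also have "\<dots> = [:0, 1:] ^ e * [:substitute v f:]"
    unfolding mp_eval_scale[OF f] by (simp only: hom_mp_eval[OF comm_ring_hom_pCons_0])
  finally show ?thesis .
qed

text \<open>Numerators of elements of the maximal ideal vanish at \<open>p\<close>, so they expand
  to multiples of \<open>t\<close>; orders add under products, and a common denominator only
  multiplies numerators further. Non-membership in a power thus becomes a question of divisibility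
  by powers of \<open>t\<close>.\<close>

lemma max_ideal_power_expand:
  assumes "x \<in> max_ideal_power n p k"
  shows "\<exists>a b. x = Fract a b \<and> eval_at p b \<noteq> 0 \<and> [:0, 1:] ^ k dvd expand p a"
  using assms
proof (induction k arbitrary: x)
  case 0
  then show ?case by (auto simp: local_ring_def)
next
  case (Suc k)
  from Suc.prems have "x \<in> ideal_product (max_ideal n p) (max_ideal_power n p k)" by simp
  then show ?case
  proof (induction rule: ideal_product_induct)
    case zero
    show ?case
      by (intro exI[of _ 0] exI[of _ 1]) (auto simp: Zero_fract_def)
  next
    case (add x u v)
    then obtain a b where x: "x = Fract a b" "eval_at p b \<noteq> 0" "[:0, 1:] ^ Suc k dvd expand p a"
      by blast
    obtain a1 b1 where u: "u = Fract a1 b1" "eval_at p b1 \<noteq> 0" "eval_at p a1 = 0"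
      using add(2) by (auto simp: max_ideal_def)
    obtain a2 b2 where v: "v = Fract a2 b2" "eval_at p b2 \<noteq> 0" "[:0, 1:] ^ k dvd expand p a2"
      using Suc.IH[OF add(3)] by blast
    have "[:0, 1:] dvd expand p a1"
      using u(3) poly_expand_0[of p a1] poly_eq_0_iff_dvd[of "expand p a1" 0] by simp
    then have 1: "[:0, 1:] ^ Suc k dvd expand p (a1 * a2)"
      using v(3) by (simp add: expand.hom_mult mult_dvd_mono del: mult_pCons_left)
    have nz: "b \<noteq> 0" "b1 \<noteq> 0" "b2 \<noteq> 0" using x(2) u(2) v(2) by auto
    show ?case
    proof (intro exI conjI)
      show "x + u * v = Fract (a * (b1 * b2) + a1 * a2 * b) (b * (b1 * b2))"
        using nz by (simp add: x u v)
      show "eval_at p (b * (b1 * b2)) \<noteq> 0"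
        using x u v by (simp add: eval.hom_mult)
      show "[:0, 1:] ^ Suc k dvd expand p (a * (b1 * b2) + a1 * a2 * b)"
        unfolding expand.hom_add expand.hom_mult[of _ a] expand.hom_mult[of _ "a1 * a2"]
        using x(3) 1 by (intro dvd_add dvd_mult2)
    qed
  qed
qed

text \<open>As \<open>B\<close> has nonzero constant term, every factor of the prime
  \<open>t\<close> must come from \<open>A\<close>. This is how denominators are discarded.\<close>

lemma X_power_dvd_mult_cancel:
  fixes A B :: "'a::idom poly"
  assumes "[:0, 1:] ^ k dvd A * B" "poly B 0 \<noteq> 0"
  shows "[:0, 1:] ^ k dvd A"
  using assms(1)
proof (induction k arbitrary: A)
  case (Suc k)
  then have "[:0, 1:] dvd A * B" by (metis dvd_mult_left power_Suc)
  then have "poly (A * B) 0 = 0" using poly_eq_0_iff_dvd[of "A * B" 0] by simp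
  then have "[:0, 1:] dvd A" using assms(2) poly_eq_0_iff_dvd[of A 0] by simp
  then obtain A' where A: "A = [:0, 1:] * A'" by (rule dvdE)
  from Suc.prems have "[:0, 1:] ^ k dvd A' * B"
    unfolding A power_Suc mult.assoc by (simp only: dvd_mult_cancel_left) simp
  from Suc.IH[OF this] show ?case
    unfolding A power_Suc by (intro mult_dvd_mono dvd_refl)
qed simp

text \<open>In the affine coordinates \<open>y i / y a\<close>, centred at \<open>p\<close>, the
  polynomial \<open>g\<close> becomes a form \<open>A\<close> of degree \<open>d - 1\<close> plus a
  form \<open>B\<close> of degree \<open>d\<close>. Its initial form is \<open>A\<close>, nonzero by
  \<open>nz\<close>.\<close>

lemma singularity_of_multiplicity_if_linear:
  fixes y :: "nat \<Rightarrow> mpoly"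
  assumes d: "d > 2" and a: "a \<le> n" and y: "\<And>i. i \<le> n \<Longrightarrow> y i \<in> S_comp n 1"
    and p: "\<And>i. i \<le> n \<Longrightarrow> eval_at p (y i) = (if i = a then 1 else 0)"
    and A: "A \<in> forms ({..n} - {a}) (d - 1)" and B: "B \<in> forms ({..n} - {a}) d"
    and nz: "substitute y A \<noteq> 0"
    and g: "g = y a * substitute y A + substitute y B"
  shows "singularity_of_multiplicity n d g p (d - 1)"
proof -
  let ?I = "{..n} - {a}" and ?t = "[:0, 1:] :: mpoly poly"
  have v: "\<And>i. i \<in> ?I \<Longrightarrow> y i \<in> S_comp n 1" "\<And>i. i \<in> ?I \<Longrightarrow> eval_at p (y i) = 0"
    using y p by auto
  have h: "y a \<in> S_comp n 1" "eval_at p (y a) = 1" "eval_at p (y a) \<noteq> 0" using y p a by auto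
  have h0: "y a \<noteq> 0" using h(3) by auto
  have hd: "y a ^ d \<in> S_comp n d" using forms_power[OF h(1), of d] by simp
  \<comment> \<open>At the zero vector the linear form \<open>y a\<close> would vanish, but it is 1
    at \<open>p\<close>.\<close>
  have proj: "proj_point n p"
  proof (rule ccontr)
    assume "\<not> proj_point n p"
    then have "eval_at p (y a) = eval_at (\<lambda>i. 0 * p i) (y a)"
      using h(1) by (intro mp_eval_cong[of _ "{..n}"]) (auto simp: proj_point_def forms_def)
    also have "\<dots> = 0" by (subst mp_eval_scale[OF h(1)]) simp
    finally show False using h by simp
  qed
  have eval_0: "eval_at p (substitute y F) = 0" if "F \<in> forms ?I e" "e > 0" for F e
  proof -
    have "eval_at p (substitute y F) = mp_eval (\<lambda>c. c) (\<lambda>i. eval_at p (y i)) F"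
      by (simp add: hom_mp_eval[OF eval.comm_ring_hom_axioms])
    also have "\<dots> = mp_eval (\<lambda>c. c) (\<lambda>i. 0 * p i) F"
      using that v by (intro mp_eval_cong[of _ ?I]) (auto simp: forms_def)
    also have "\<dots> = 0" using that by (subst mp_eval_scale) auto
    finally show ?thesis .
  qed
  have "eval_at p g = 0"
    using d eval_0[OF A] eval_0[OF B] by (simp add: g eval.hom_add eval.hom_mult)
  moreover have "has_multiplicity n d g p (d - 1)"
    unfolding has_multiplicity_def
  proof (intro exI conjI)
    show "local_equation n d g p (Fract g (y a ^ d))"
      unfolding local_equation_def using hd h by (intro bexI[of _ "y a ^ d"]) (auto simp: eval.hom_power)
    have *: "y a ^ d = y a * y a ^ (d - 1)" using d by (cases d) auto
    have "Fract g (y a ^ d) = Fract (substitute y A) (y a ^ (d - 1)) + Fract (substitute y B) (y a ^ d)"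
    proof -
      have "Fract g (y a ^ d) = Fract (y a * substitute y A) (y a ^ d) + Fract (substitute y B) (y a ^ d)"
        unfolding g using h0 by (intro Fract_add) simp
      then show ?thesis unfolding * mult_fract_cancel[OF h0] .
    qed
    then show "Fract g (y a ^ d) \<in> max_ideal_power n p (d - 1)"
      using Fract_substitute_in_max_ideal_power[OF h(1,3) v A, where k = "d - 1"]
        Fract_substitute_in_max_ideal_power[OF h(1,3) v B, where k = "d - 1"] d
      by (auto intro: max_ideal_power_add)
    show "Fract g (y a ^ d) \<notin> max_ideal_power n p (Suc (d - 1))"
    proof
      assume "Fract g (y a ^ d) \<in> max_ideal_power n p (Suc (d - 1))"
      moreover have "Suc (d - 1) = d" using d by simp
      ultimately have "Fract g (y a ^ d) \<in> max_ideal_power n p d" by (simp only:)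
      from max_ideal_power_expand[OF this] obtain a' b
        where ab: "Fract g (y a ^ d) = Fract a' b" "eval_at p b \<noteq> 0" "?t ^ d dvd expand p a'"
        by blast
      \<comment> \<open>Cross-multiplying leaves an equation of polynomials; \<open>b\<close> does
        not vanish at \<open>p\<close>, so it carries no factor \<open>t\<close> after
        expansion.\<close>
      have "g * b = a' * y a ^ d"
        using ab h0 by (subst (asm) eq_fract) auto
      then have "?t ^ d dvd expand p g * expand p b"
        using ab(3) by (metis expand.hom_mult dvd_mult2)
      then have "?t ^ d dvd expand p g"
        by (rule X_power_dvd_mult_cancel) (use ab(2) in \<open>simp add: poly_expand_0\<close>)
      moreover have "expand p (substitute y F) = ?t ^ e * [:substitute y F:]" if "F \<in> forms ?I e" for F e
        by (rule expand_substitute[OF that]) (use v in auto)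
      \<comment> \<open>Since \<open>y a\<close> has value 1 at \<open>p\<close>, it expands to
        \<open>1 + t y\<^sub>a\<close>; the coefficient of \<open>t ^ (d - 1)\<close> in the
        expansion of \<open>g\<close> is therefore \<open>substitute y A\<close>.\<close>
      from this[OF A] this[OF B] have "expand p g = ?t ^ (d - 1) * ([:1, y a:] * [:substitute y A:]) + ?t ^ d * [:substitute y B:]"
        unfolding g expand.hom_add expand.hom_mult expand_linear[OF h(1) finite_atMost] h(2)
        by (simp only: Const.hom_one mult_ac)
      ultimately have "?t ^ d dvd ?t ^ (d - 1) * ([:1, y a:] * [:substitute y A:])"
        by (simp only: dvd_add_left_iff dvd_triv_left)
      moreover have "?t ^ d = ?t ^ (d - 1) * ?t" using d by (cases d) (auto simp only: power_Suc2 diff_Suc_1 diff_Suc_1')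
      ultimately have "?t dvd [:1, y a:] * [:substitute y A:]"
        by (simp only: dvd_mult_cancel_left) (simp del: mult_pCons_left mult_pCons_right)
      then have "poly ([:1, y a:] * [:substitute y A:]) 0 = 0"
        using poly_eq_0_iff_dvd[of "[:1, y a:] * [:substitute y A:]" 0] by simp
      then show False using nz by simp
    qed
  qed
  ultimately show ?thesis using proj d by (auto simp: singularity_of_multiplicity_def)
qed

section \<open>Coordinates adapted to a self-adjoint matrix\<close>

text \<open>A nonzero off-diagonal entry lies inside one block, where the diagonal is constant. The
  induction peels off the first block; index pairs avoiding it are shifted by its size
  \<open>k\<close>.\<close>

lemma jordan_matrix_entries:
  fixes n_as :: "(nat \<times> 'a::zero_neq_one) list"
  assumes "i < sum_list (map fst n_as)" "j < sum_list (map fst n_as)" "jordan_matrix n_as $$ (i, j) \<noteq> 0"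
  shows "j = i \<or> j = Suc i \<and> jordan_matrix n_as $$ (i, j) = 1 \<and>
    jordan_matrix n_as $$ (i, i) = jordan_matrix n_as $$ (j, j)"
  using assms
proof (induction n_as arbitrary: i j)
  case (Cons x n_as)
  obtain k a where x: "x = (k, a)" by force
  have J: "jordan_matrix (x # n_as) = four_block_mat (jordan_block k a) (0\<^sub>m k (sum_list (map fst n_as)))
      (0\<^sub>m (sum_list (map fst n_as)) k) (jordan_matrix n_as)"
    using jordan_matrix_dim[of n_as] by (simp add: jordan_matrix_def x Let_def)
  show ?case
  proof (cases "i < k \<or> j < k")
    case True
    then show ?thesis using Cons.prems unfolding J by (auto simp: x split: if_splits)
  next
    case False
    then obtain i' j' where "i = k + i'" "j = k + j'" by (auto simp: not_less le_iff_add)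
    then show ?thesis using Cons.prems Cons.IH[of i' j'] unfolding J by (simp add: x)
  qed
qed simp

lemma forms_linear_combination: "(\<Sum>i\<le>n. Const (c i) * Var i) \<in> S_comp n 1"
  by (intro forms_sum forms_Const_mult forms_Var) auto

text \<open>The columns of \<open>P\<close> form a Jordan basis for the transpose of
  \<open>c\<close>. Substituting the linear forms \<open>w\<close> with coefficient matrix
  \<open>P\<close> turns the Hessian into the Gram matrix \<open>G\<close> of this basis, and
  self-adjointness becomes \<open>G * Jm = Jm\<^sup>T * G\<close>. Both alternatives are read off
  from entries of that equation; \<open>y\<close> is the inverse substitution, with matrix
  \<open>Q\<close>.\<close>

lemma adapted_coordinates:
  fixes c :: "nat \<Rightarrow> nat \<Rightarrow> complex"
  assumes g: "g \<in> S_ring n"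
    and sym: "\<And>j k. j \<le> n \<Longrightarrow> k \<le> n \<Longrightarrow>
      (\<Sum>l\<le>n. Const (c j l) * partial k (partial l g)) = (\<Sum>l\<le>n. Const (c k l) * partial j (partial l g))"
    and nonscalar: "\<not> (\<exists>t. \<forall>i\<le>n. \<forall>j\<le>n. c i j = (if i = j then t else 0))"
  obtains y w where
    "\<And>i. i \<le> n \<Longrightarrow> y i \<in> S_comp n 1" "\<And>i. i \<le> n \<Longrightarrow> w i \<in> S_comp n 1"
    "\<And>i. i \<le> n \<Longrightarrow> substitute y (w i) = Var i" "\<And>i. i \<le> n \<Longrightarrow> substitute w (y i) = Var i"
    "(\<exists>a\<le>n. partial a (partial a (substitute w g)) = 0) \<or>
     (\<exists>A. A \<noteq> {} \<and> A \<subset> {..n} \<and>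
        (\<forall>i\<in>A. \<forall>j\<in>{..n} - A. partial i (partial j (substitute w g)) = 0))"
proof -
  define N where "N = Suc n"
  have lessN: "i < N \<longleftrightarrow> i \<le> n" for i by (auto simp: N_def)
  have setN: "{0..<N} = {..n}" by (auto simp: N_def)
  \<comment> \<open>With the transpose, \<open>sym\<close> becomes
    \<open>H * Dm = Dm\<^sup>T * H\<close> for the Hessian \<open>H\<close> introduced
    below.\<close>
  define D where "D = mat N N (\<lambda>(l, j). c j l)"
  have D: "D \<in> carrier_mat N N" by (simp add: D_def)
  obtain as where "char_poly D = (\<Prod>a\<leftarrow>as. [:- a, 1:])"
    using char_poly_factorized[OF D] by blast
  from jordan_nf_exists[OF D this] obtain n_as where "jordan_nf D n_as" ..
  then obtain P Q where wit: "similar_mat_wit D (jordan_matrix n_as) P Q"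
    by (auto simp: jordan_nf_def similar_mat_def)
  define J where "J = jordan_matrix n_as"
  have PQ: "P * Q = 1\<^sub>m N" "Q * P = 1\<^sub>m N" "D = P * J * Q"
    and [simp]: "J \<in> carrier_mat N N" "P \<in> carrier_mat N N" "Q \<in> carrier_mat N N"
    using similar_mat_witD2[OF D wit] by (auto simp: J_def)
  note [simp] = mult_carrier_mat[of _ N N _ N] carrier_matD[OF \<open>P \<in> carrier_mat N N\<close>]
    carrier_matD[OF \<open>J \<in> carrier_mat N N\<close>]
  have "N = sum_list (map fst n_as)"
    using carrier_matD(1)[OF \<open>J \<in> carrier_mat N N\<close>] by (simp add: J_def)
  then have entries: "j = i \<or> j = Suc i \<and> J $$ (i, j) = 1 \<and> J $$ (i, i) = J $$ (j, j)"
    if "J $$ (i, j) \<noteq> 0" "i \<le> n" "j \<le> n" for i j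
    using jordan_matrix_entries[of i n_as j] that by (auto simp: J_def lessN[symmetric])
  have "D * P = P * J * (Q * P)"
    unfolding PQ(3) by (rule assoc_mult_mat[of _ N N _ N _ N]) auto
  then have DP: "D * P = P * J" by (simp add: PQ(2) right_mult_one_mat[of _ N N])

  define w where "w j = (\<Sum>i\<le>n. Const (P $$ (j, i)) * Var i)" for j
  define y where "y j = (\<Sum>i\<le>n. Const (Q $$ (j, i)) * Var i)" for j
  have subst_lin: "substitute v (\<Sum>i\<le>n. Const (a i) * Var i) = (\<Sum>i\<le>n. Const (a i) * v i)" for v a
    by (simp add: subst.hom_sum subst.hom_mult substitute_Const substitute_Var)
  \<comment> \<open>Kept general in the two matrices: \<open>P * Q\<close> handles \<open>y\<close>
    after \<open>w\<close>, and \<open>Q * P\<close> the other composition.\<close>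
  have inv: "(\<Sum>k\<le>n. Const (A $$ (i, k)) * (\<Sum>j\<le>n. Const (B $$ (k, j)) * Var j)) = Var i"
    if "A * B = 1\<^sub>m N" "A \<in> carrier_mat N N" "B \<in> carrier_mat N N" "i \<le> n" for A B i
  proof -
    have "(\<Sum>k\<le>n. Const (A $$ (i, k)) * (\<Sum>j\<le>n. Const (B $$ (k, j)) * Var j)) =
        (\<Sum>j\<le>n. Const (\<Sum>k\<le>n. A $$ (i, k) * B $$ (k, j)) * Var j)"
      by (simp add: sum_distrib_left sum_distrib_right Const.hom_sum Const.hom_mult mult.assoc)
        (rule sum.swap)
    also have "\<dots> = (\<Sum>j\<le>n. Const ((A * B) $$ (i, j)) * Var j)"
      using that(2-) by (intro sum.cong refl) (auto simp: scalar_prod_def lessN setN)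
    also have "\<dots> = (\<Sum>j\<le>n. if j = i then Var j else 0)"
      unfolding that(1) using that(4) by (intro sum.cong) (auto simp: lessN)
    finally show ?thesis using that by simp
  qed

  define H where "H = mat N N (\<lambda>(i, j). substitute w (partial i (partial j g)))"
  define G where "G = mat N N (\<lambda>(i, j). partial i (partial j (substitute w g)))"
  define Dm where "Dm = map_mat Const D"
  define Pm where "Pm = map_mat Const P"
  define Jm where "Jm = map_mat Const J"
  have [simp]: "H \<in> carrier_mat N N" "G \<in> carrier_mat N N" "Dm \<in> carrier_mat N N"
      "Pm \<in> carrier_mat N N" "Jm \<in> carrier_mat N N"
    using D by (auto simp: H_def G_def Dm_def Pm_def Jm_def)
  have HD: "H * Dm = Dm\<^sup>T * H"
  proof (rule eq_matI)
    fix i j assume "i < dim_row (Dm\<^sup>T * H)" "j < dim_col (Dm\<^sup>T * H)"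
    then have ij: "i \<le> n" "j \<le> n" by (auto simp: Dm_def H_def D_def lessN)
    have "(H * Dm) $$ (i, j) = substitute w (\<Sum>l\<le>n. Const (c j l) * partial i (partial l g))"
      using ij by (auto simp: H_def Dm_def D_def scalar_prod_def lessN setN subst.hom_sum
          subst.hom_mult substitute_Const mult.commute intro!: sum.cong)
    also have "\<dots> = substitute w (\<Sum>l\<le>n. Const (c i l) * partial l (partial j g))"
      using sym[of j i] ij by (simp add: partial_commute[of _ j])
    also have "\<dots> = (Dm\<^sup>T * H) $$ (i, j)"
      using ij by (auto simp: H_def Dm_def D_def scalar_prod_def lessN setN subst.hom_sum
          subst.hom_mult substitute_Const intro!: sum.cong)
    finally show "(H * Dm) $$ (i, j) = (Dm\<^sup>T * H) $$ (i, j)" .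
  qed (auto simp: Dm_def H_def D_def)
  have partial_w: "partial a (w j) = Const (P $$ (j, a))" if "a \<le> n" for a j
  proof -
    have "partial a (w j) = (\<Sum>i\<le>n. if i = a then Const (P $$ (j, i)) else 0)"
      unfolding w_def partial_sum by (intro sum.cong) (auto simp: partial_Const_mult partial_Var)
    then show ?thesis using that by simp
  qed
  have partial_G: "partial a (substitute w f) = (\<Sum>j\<le>n. substitute w (partial j f) * Const (P $$ (j, a)))"
    if "a \<le> n" "f \<in> S_ring n" for a f
    using partial_substitute[OF that(2), of a w] that by (simp add: partial_w)
  \<comment> \<open>The chain rule twice; the second derivatives of the linear forms
    \<open>w\<close> vanish, so only the congruence by \<open>Pm\<close> remains.\<close>
  have GH: "G = Pm\<^sup>T * H * Pm"
  proof (rule eq_matI)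
    fix a b assume "a < dim_row (Pm\<^sup>T * H * Pm)" "b < dim_col (Pm\<^sup>T * H * Pm)"
    then have ab: "a \<le> n" "b \<le> n" by (auto simp: Pm_def lessN)
    have "partial a (partial b (substitute w g)) =
      (\<Sum>j\<le>n. (\<Sum>i\<le>n. substitute w (partial i (partial j g)) * Const (P $$ (i, a))) * Const (P $$ (j, b)))"
      using ab g by (simp add: partial_G partial_sum partial_mult polys_partial)
    also have "\<dots> = (Pm\<^sup>T * H * Pm) $$ (a, b)"
      using ab by (auto simp: H_def Pm_def scalar_prod_def lessN setN mult.commute intro!: sum.cong)
    finally show "G $$ (a, b) = (Pm\<^sup>T * H * Pm) $$ (a, b)" using ab by (simp add: G_def lessN)
  qed (auto simp: G_def Pm_def)
  have DPm: "Dm * Pm = Pm * Jm"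
    using Const.mat_hom_mult[OF D \<open>P \<in> carrier_mat N N\<close>]
      Const.mat_hom_mult[OF \<open>P \<in> carrier_mat N N\<close> \<open>J \<in> carrier_mat N N\<close>]
    by (simp add: DP Dm_def Pm_def Jm_def)
  \<comment> \<open>\<open>Pm * Jm\<close> is traded for \<open>Dm * Pm\<close>, then
    \<open>Dm\<close> passes through \<open>H\<close> as its transpose, and the product is traded
    back on the left.\<close>
  have "G * Jm = Pm\<^sup>T * (H * Dm) * Pm"
    unfolding GH by (simp add: assoc_mult_mat[of _ N N _ N _ N] DPm)
  also have "\<dots> = (Dm * Pm)\<^sup>T * H * Pm"
    unfolding HD by (simp add: assoc_mult_mat[of _ N N _ N _ N] transpose_mult[of _ N N _ N])
  also have "\<dots> = Jm\<^sup>T * G"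
    unfolding GH DPm by (simp add: assoc_mult_mat[of _ N N _ N _ N] transpose_mult[of _ N N _ N])
  finally have GJ: "G * Jm = Jm\<^sup>T * G" .
  have GJ_entry: "(\<Sum>k\<le>n. G $$ (a, k) * Const (J $$ (k, b))) = (\<Sum>k\<le>n. Const (J $$ (k, a)) * G $$ (k, b))"
    if "a \<le> n" "b \<le> n" for a b
  proof -
    have "(G * Jm) $$ (a, b) = (\<Sum>k\<le>n. G $$ (a, k) * Const (J $$ (k, b)))"
      using that carrier_matD[OF \<open>G \<in> carrier_mat N N\<close>]
      by (auto simp: Jm_def scalar_prod_def lessN setN intro!: sum.cong)
    moreover have "(Jm\<^sup>T * G) $$ (a, b) = (\<Sum>k\<le>n. Const (J $$ (k, a)) * G $$ (k, b))"
      using that carrier_matD[OF \<open>G \<in> carrier_mat N N\<close>]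
      by (auto simp: Jm_def scalar_prod_def lessN setN intro!: sum.cong)
    ultimately show ?thesis using GJ by simp
  qed
  have G_entry: "G $$ (a, b) = partial a (partial b (substitute w g))" if "a \<le> n" "b \<le> n" for a b
    using that by (simp add: G_def lessN)

  show thesis
  proof (rule that[of y w])
    show "y i \<in> S_comp n 1" "w i \<in> S_comp n 1" for i
      unfolding y_def w_def by (rule forms_linear_combination)+
    show "substitute y (w i) = Var i" if "i \<le> n" for i
      unfolding w_def subst_lin unfolding y_def by (rule inv) (use that PQ in auto)
    show "substitute w (y i) = Var i" if "i \<le> n" for i
      unfolding y_def subst_lin unfolding w_def by (rule inv) (use that PQ in auto)
    show "(\<exists>a\<le>n. partial a (partial a (substitute w g)) = 0) \<or>
     (\<exists>A. A \<noteq> {} \<and> A \<subset> {..n} \<and>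
        (\<forall>i\<in>A. \<forall>j\<in>{..n} - A. partial i (partial j (substitute w g)) = 0))"
    proof (cases "\<exists>a. Suc a \<le> n \<and> J $$ (a, Suc a) \<noteq> 0")
      case True
      \<comment> \<open>The least such index starts its Jordan block: nothing stands above the
        diagonal in column \<open>a\<close>, so basis vector \<open>a\<close> is an eigenvector and
        basis vector \<open>Suc a\<close> is next in its chain.\<close>
      define a where "a = (LEAST a. Suc a \<le> n \<and> J $$ (a, Suc a) \<noteq> 0)"
      have a: "Suc a \<le> n" "J $$ (a, Suc a) \<noteq> 0"
        using LeastI_ex[OF True] by (auto simp: a_def)
      have below: "J $$ (k, Suc k) = 0" if "Suc k = a" for k
        using not_less_Least[of k "\<lambda>a. Suc a \<le> n \<and> J $$ (a, Suc a) \<noteq> 0"] that a by (auto simp: a_def)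
      have J1: "J $$ (a, Suc a) = 1" "J $$ (a, a) = J $$ (Suc a, Suc a)"
        using entries[OF a(2)] a by auto
      have "(\<Sum>k\<le>n. G $$ (a, k) * Const (J $$ (k, Suc a))) =
          (\<Sum>k\<in>{a, Suc a}. G $$ (a, k) * Const (J $$ (k, Suc a)))"
        using a entries by (intro sum.mono_neutral_right) fastforce+
      moreover have "(\<Sum>k\<le>n. Const (J $$ (k, a)) * G $$ (k, Suc a)) =
          (\<Sum>k\<in>{a}. Const (J $$ (k, a)) * G $$ (k, Suc a))"
        using a entries below by (intro sum.mono_neutral_right) fastforce+
      \<comment> \<open>Both sides contain the common eigenvalue times
        \<open>G $$ (a, Suc a)\<close>; the only other term is \<open>G $$ (a, a)\<close>, from the
        entry 1 above the diagonal.\<close>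
      ultimately have "G $$ (a, a) = 0"
        using GJ_entry[of a "Suc a"] a J1 by simp
      then show ?thesis using a G_entry[of a a] by auto
    next
      case False
      then have diag: "J $$ (i, j) = 0" if "i \<le> n" "j \<le> n" "i \<noteq> j" for i j
        using entries that by blast
      \<comment> \<open>All basis vectors for one eigenvalue, that of index 0. If they exhausted the
        basis, \<open>D\<close> would be scalar.\<close>
      define A where "A = {i. i \<le> n \<and> J $$ (i, i) = J $$ (0, 0)}"
      have "A \<noteq> {}" "A \<subseteq> {..n}" by (auto simp: A_def)
      moreover have "A \<noteq> {..n}"
      proof
        assume "A = {..n}"
        then have J: "J = J $$ (0, 0) \<cdot>\<^sub>m 1\<^sub>m N"
          using diag by (intro eq_matI) (auto simp: A_def lessN)
        have "D = J $$ (0, 0) \<cdot>\<^sub>m (P * Q)"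
          unfolding PQ(3) by (subst J) (simp add: mult_smult_distrib[of _ N N _ N] mult_smult_assoc_mat[of _ N N _ N])
        then have "D = J $$ (0, 0) \<cdot>\<^sub>m 1\<^sub>m N" by (simp only: PQ(1))
        then have "D $$ (j, i) = (if i = j then J $$ (0, 0) else 0)" if "i \<le> n" "j \<le> n" for i j
          using that by (auto simp: lessN)
        then have "c i j = (if i = j then J $$ (0, 0) else 0)" if "i \<le> n" "j \<le> n" for i j
          using that by (simp add: D_def lessN)
        then show False using nonscalar by blast
      qed
      moreover have "G $$ (i, j) = 0" if "i \<in> A" "j \<in> {..n} - A" for i j
      proof -
        have ij: "i \<le> n" "j \<le> n" "J $$ (i, i) \<noteq> J $$ (j, j)" using that by (auto simp: A_def)
        have "(\<Sum>k\<le>n. G $$ (i, k) * Const (J $$ (k, j))) = (\<Sum>k\<in>{j}. G $$ (i, k) * Const (J $$ (k, j)))"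
          using ij diag by (intro sum.mono_neutral_right) auto
        moreover have "(\<Sum>k\<le>n. Const (J $$ (k, i)) * G $$ (k, j)) = (\<Sum>k\<in>{i}. Const (J $$ (k, i)) * G $$ (k, j))"
          using ij diag by (intro sum.mono_neutral_right) auto
        ultimately have "G $$ (i, j) * Const (J $$ (j, j)) = Const (J $$ (i, i)) * G $$ (i, j)"
          using GJ_entry[of i j] ij by (simp only: sum.insert) simp
        then show ?thesis using ij by (simp add: mult.commute)
      qed
      moreover have "G $$ (i, j) = partial i (partial j (substitute w g))" if "i \<in> A" "j \<in> {..n} - A" for i j
        using that by (intro G_entry) (auto simp: A_def)
      ultimately show ?thesis by (intro disjI2 exI[of _ A]) (auto simp: psubset_eq)
    qed
  qed
qed

section \<open>Comparing the two tangent spaces\<close>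

lemma lookup_single_mult:
  fixes f :: mpoly
  shows "Poly_Mapping.lookup (Poly_Mapping.single m c * f) (m + m') = c * Poly_Mapping.lookup f m'"
  by (induction f rule: mpoly_single_induct)
    (auto simp: mult_single lookup_single when_def distrib_left lookup_add)

lemma mdeg_1_eq_single:
  assumes "mdeg m = 1" "i \<in> Poly_Mapping.keys m"
  shows "m = Poly_Mapping.single i 1"
proof -
  have "mdeg (m - Poly_Mapping.single i 1) = 0"
    using arg_cong[OF monom_decompose[OF assms(2)], of mdeg] assms(1) by (simp add: mdeg_add)
  then show ?thesis using monom_decompose[OF assms(2)] by simp
qed

text \<open>Every monomial of \<open>x\<^sub>i L\<close> is divisible by \<open>x\<^sub>j\<close>.
  As \<open>i\<close> and \<open>j\<close> differ, this factor comes from \<open>L\<close>, whose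
  monomials have degree 1.\<close>

lemma linear_form_multiple_of_Var:
  assumes "L \<in> forms I 1" "i \<noteq> j" "Var i * L = Var j * M"
  obtains c where "L = Const c * Var j"
proof -
  have "m = Poly_Mapping.single j 1" if m: "m \<in> Poly_Mapping.keys L" for m
  proof (rule mdeg_1_eq_single)
    show "mdeg m = 1" using m assms(1) by (simp add: forms_def)
    have "Poly_Mapping.single i 1 + m \<in> Poly_Mapping.keys (Var j * M)"
      using m unfolding assms(3)[symmetric] by (simp add: in_keys_iff Var_def lookup_single_mult)
    then obtain m' where "Poly_Mapping.single i 1 + m = Poly_Mapping.single j 1 + m'"
      using keys_mult[of "Var j" M] by (auto simp: Var_def)
    then have "j \<in> Poly_Mapping.keys (Poly_Mapping.single i 1 + m)" by (simp add: keys_add_monom)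
    then show "j \<in> Poly_Mapping.keys m" using assms(2) by (simp add: keys_add_monom)
  qed
  then have "L = Const (Poly_Mapping.lookup L (Poly_Mapping.single j 1)) * Var j"
    by (intro poly_mapping_eqI)
      (auto simp: Const_def Var_def mult_single lookup_single when_def in_keys_iff)
  then show thesis by (rule that)
qed

definition hom_component :: "nat \<Rightarrow> mpoly \<Rightarrow> mpoly" where
  "hom_component e f = (\<Sum>m\<in>{m \<in> Poly_Mapping.keys f. mdeg m = e}. Poly_Mapping.single m (Poly_Mapping.lookup f m))"

lemma lookup_hom_component:
  "Poly_Mapping.lookup (hom_component e f) m = (if mdeg m = e then Poly_Mapping.lookup f m else 0)"
  by (auto simp: hom_component_def lookup_sum lookup_single when_def in_keys_iff)

lemma hom_component_add: "hom_component e (f + g) = hom_component e f + hom_component e g"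
  by (rule poly_mapping_eqI) (simp add: lookup_hom_component lookup_add)

lemma hom_component_sum: "hom_component e (sum f A) = (\<Sum>i\<in>A. hom_component e (f i))"
  by (induction A rule: infinite_finite_induct) (auto simp: hom_component_add, auto simp: hom_component_def)

lemma hom_component_forms: "f \<in> forms I d \<Longrightarrow> hom_component e f = (if d = e then f else 0)"
  by (rule poly_mapping_eqI) (auto simp: lookup_hom_component forms_def in_keys_iff)

lemma hom_component_in_forms: "f \<in> polys I \<Longrightarrow> hom_component e f \<in> forms I e"
  by (auto simp: forms_def polys_def in_keys_iff lookup_hom_component split: if_splits)

lemma hom_component_mult:
  assumes "b \<in> forms I d"
  shows "hom_component (e + d) (a * b) = hom_component e a * b"
proof (induction a rule: mpoly_single_induct)
  case (single m c)
  have 1: "Poly_Mapping.single m c \<in> forms UNIV (mdeg m)" by (simp add: forms_def polys_def)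
  have "b \<in> forms UNIV d" using assms by (rule forms_mono) simp
  from hom_component_forms[OF forms_mult[OF 1 this]] hom_component_forms[OF 1]
  show ?case by simp
qed (simp add: hom_component_add algebra_simps)

text \<open>The Jacobian ideal allows arbitrary polynomial coefficients. The derivatives of
  \<open>g\<close> are forms of degree \<open>d\<close>, so the component of degree
  \<open>1 + d\<close>, which is all of \<open>F\<close>, only sees the linear parts of the
  coefficients.\<close>

lemma orbit_tangent_space_linear:
  assumes "g \<in> S_comp n (Suc d)" "F \<in> orbit_tangent_space n (Suc d) g"
  obtains L where "\<And>l. l \<le> n \<Longrightarrow> L l \<in> S_comp n 1" "F = (\<Sum>l\<le>n. L l * partial l g)"
proof -
  from assms(2) obtain a where a: "F = (\<Sum>l\<le>n. a l * partial l g)" "\<forall>l\<le>n. a l \<in> S_ring n"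
    and F: "F \<in> S_comp n (Suc d)"
    by (auto simp: orbit_tangent_space_def jacobian_ideal_def)
  have "F = hom_component (1 + d) F" using hom_component_forms[OF F] by simp
  also have "\<dots> = (\<Sum>l\<le>n. hom_component 1 (a l) * partial l g)"
    unfolding a(1) hom_component_sum
    by (intro sum.cong refl hom_component_mult[OF forms_partial[OF assms(1)]])
  finally show thesis
    using a(2) by (intro that[of "\<lambda>l. hom_component 1 (a l)"]) (auto intro: hom_component_in_forms)
qed

lemma Var_mult_partial_in_orbit_tangent_space:
  assumes "f \<in> S_comp n (Suc d)" "k \<le> n" "j \<le> n"
  shows "Var k * partial j f \<in> orbit_tangent_space n (Suc d) f"
proof -
  have V: "Var k \<in> S_comp n 1" using assms by (intro forms_Var) auto
  have "(\<Sum>l\<le>n. (if l = j then Var k else 0) * partial l f) = (\<Sum>l\<le>n. if l = j then Var k * partial l f else 0)"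
    by (intro sum.cong) auto
  then have "Var k * partial j f = (\<Sum>l\<le>n. (if l = j then Var k else 0) * partial l f)"
    using assms by simp
  then have "Var k * partial j f \<in> jacobian_ideal n f"
    unfolding jacobian_ideal_def using V
    by (intro CollectI exI[of _ "\<lambda>l. if l = j then Var k else 0"]) (auto simp: forms_def polys_def)
  moreover have "Var k * partial j f \<in> S_comp n (Suc d)"
    using forms_mult[OF V forms_partial[OF assms(1)]] by simp
  ultimately show ?thesis by (simp add: orbit_tangent_space_def)
qed

lemma AR_eq_0_if_less_mdr0:
  assumes "m < mdr0 n g" "\<And>j. j \<le> n \<Longrightarrow> a j \<in> S_comp n m" "(\<Sum>j\<le>n. a j * partial j g) = 0" "j \<le> n"
  shows "a j = 0"
proof -
  have "AR n g m = {\<lambda>_. 0}"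
    using not_less_Least[of m "\<lambda>m. AR n g m \<noteq> {\<lambda>_. 0}"] assms(1) by (auto simp: mdr0_def)
  \<comment> \<open>\<open>AR\<close> asks for tuples vanishing beyond \<open>n\<close>, while
    \<open>a\<close> is unconstrained there.\<close>
  moreover have "(\<lambda>j. if j \<le> n then a j else 0) \<in> AR n g m"
    using assms by (simp add: AR_def)
  ultimately have "(\<lambda>j. if j \<le> n then a j else 0) = (\<lambda>_. 0)" by blast
  then show ?thesis using assms(4) by meson
qed

text \<open>
  \<open>x\<^sub>1 (x\<^sub>0 f\<^sub>j) = x\<^sub>0 (x\<^sub>1 f\<^sub>j)\<close> yields a quadratic syzygy of \<open>g\<close>, whose vanishing makes the
  coefficients of \<open>x\<^sub>0 f\<^sub>j\<close> divisible by \<open>x\<^sub>0\<close>.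
\<close>

lemma partial_eq_linear_combination:
  assumes n: "n \<ge> 1" and f: "f \<in> S_comp n (Suc d)" and g: "g \<in> S_comp n (Suc d)"
    and mdr: "mdr0 n g \<ge> 3"
    and T: "orbit_tangent_space n (Suc d) f = orbit_tangent_space n (Suc d) g" and j: "j \<le> n"
  obtains c where "partial j f = (\<Sum>l\<le>n. Const (c l) * partial l g)"
proof -
  have "\<exists>L. (\<forall>l\<le>n. L l \<in> S_comp n 1) \<and> Var k * partial j f = (\<Sum>l\<le>n. L l * partial l g)"
    if "k \<le> n" for k
  proof -
    have "Var k * partial j f \<in> orbit_tangent_space n (Suc d) g"
      using Var_mult_partial_in_orbit_tangent_space[OF f that j] T by simp
    from orbit_tangent_space_linear[OF g this] show ?thesis by metis
  qed
  \<comment> \<open>Here \<open>n \<ge> 1\<close> provides the two variables to compare.\<close>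
  from this[of 0] this[of 1] n obtain L M
    where L: "\<And>l. l \<le> n \<Longrightarrow> L l \<in> S_comp n 1" "Var 0 * partial j f = (\<Sum>l\<le>n. L l * partial l g)"
      and M: "\<And>l. l \<le> n \<Longrightarrow> M l \<in> S_comp n 1" "Var 1 * partial j f = (\<Sum>l\<le>n. M l * partial l g)"
    by auto
  have V: "Var 0 \<in> S_comp n 1" "Var 1 \<in> S_comp n 1" using n by (intro forms_Var; simp)+
  have "(\<Sum>l\<le>n. (Var 1 * L l - Var 0 * M l) * partial l g) =
      Var 1 * (Var 0 * partial j f) - Var 0 * (Var 1 * partial j f)"
    unfolding L(2) M(2) by (simp add: sum_distrib_left sum_subtractf left_diff_distrib mult.assoc)
  then have "(\<Sum>l\<le>n. (Var 1 * L l - Var 0 * M l) * partial l g) = 0"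
    by (simp add: mult.left_commute)
  moreover have "Var 1 * L l - Var 0 * M l \<in> S_comp n 2" if "l \<le> n" for l
    using forms_mult[OF V(2) L(1)[OF that]] forms_mult[OF V(1) M(1)[OF that]]
    by (auto intro: forms_diff simp: numeral_2_eq_2)
  ultimately have "Var 1 * L l - Var 0 * M l = 0" if "l \<le> n" for l
    using AR_eq_0_if_less_mdr0[of 2 n g "\<lambda>l. Var 1 * L l - Var 0 * M l"] mdr that by simp
  then have "\<exists>c. L l = Const c * Var 0" if "l \<le> n" for l
    using linear_form_multiple_of_Var[OF L(1), of l 1 0 "M l"] that by auto
  then obtain c where c: "\<And>l. l \<le> n \<Longrightarrow> L l = Const (c l) * Var 0" by metis
  have "Var 0 * partial j f = Var 0 * (\<Sum>l\<le>n. Const (c l) * partial l g)"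
    unfolding L(2) using c by (simp add: sum_distrib_left mult_ac)
  moreover have "Var 0 \<noteq> 0"
    by (metis Var_def lookup_single_eq lookup_zero zero_neq_one)
  ultimately show thesis by (intro that[of c]) simp
qed

text \<open>A monomial with variables from both \<open>A\<close> and its complement would survive in
  a mixed second derivative, so each monomial stays on one side. As \<open>sebastiani_thom\<close>
  wants an initial segment \<open>{..l}\<close> in place of \<open>A\<close>, the coordinates are
  also permuted.\<close>

lemma sebastiani_thom_if_split:
  fixes y w :: "nat \<Rightarrow> mpoly"
  assumes y: "\<And>i. i \<le> n \<Longrightarrow> y i \<in> S_comp n 1" and w: "\<And>i. i \<le> n \<Longrightarrow> w i \<in> S_comp n 1"
    and yw: "\<And>i. i \<le> n \<Longrightarrow> substitute y (w i) = Var i"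
    and wy: "\<And>i. i \<le> n \<Longrightarrow> substitute w (y i) = Var i"
    and g: "g \<in> S_comp n d" and d: "d > 0" and A: "A \<noteq> {}" "A \<subset> {..n}"
    and mixed: "\<And>i j. i \<in> A \<Longrightarrow> j \<in> {..n} - A \<Longrightarrow> partial i (partial j (substitute w g)) = 0"
  shows "sebastiani_thom n d g"
proof -
  define G where "G = substitute w g"
  have G: "G \<in> S_comp n d" unfolding G_def using g w by (intro forms_substitute) auto
  have fin: "finite A" using A finite_subset by blast
  obtain l where l: "card A = Suc l" using A(1) fin by (cases "card A") auto
  have "card A < card {..n}" using A by (intro psubset_card_mono) auto
  then have ln: "l < n" using l by simp
  obtain \<sigma> where \<sigma>: "bij_betw \<sigma> {..l} A"
    using finite_same_card_bij[of "{..l}" A] fin l by auto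
  have "card ({..n} - A) = card {l+1..n}"
    using A fin l by (subst card_Diff_subset) auto
  then obtain \<tau> where \<tau>: "bij_betw \<tau> {l+1..n} ({..n} - A)"
    using finite_same_card_bij[of "{l+1..n}" "{..n} - A"] by auto
  define \<pi> where "\<pi> i = (if i \<in> {..l} then \<sigma> i else \<tau> i)" for i
  have \<pi>1: "bij_betw \<pi> {..l} A"
    using \<sigma> by (rule bij_betw_cong[THEN iffD1, rotated]) (simp add: \<pi>_def)
  have \<pi>2: "bij_betw \<pi> {l+1..n} ({..n} - A)"
    using \<tau> by (rule bij_betw_cong[THEN iffD1, rotated]) (simp add: \<pi>_def)
  have "bij_betw \<pi> ({..l} \<union> {l+1..n}) (A \<union> ({..n} - A))"
    by (rule bij_betw_combine[OF \<pi>1 \<pi>2]) auto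
  moreover have "{..l} \<union> {l+1..n} = {..n}" "A \<union> ({..n} - A) = {..n}" using ln A by auto
  ultimately have \<pi>: "bij_betw \<pi> {..n} {..n}" by simp
  then have \<pi>_le: "\<pi> i \<le> n" if "i \<le> n" for i using that by (auto simp: bij_betw_def)

  define part where "part B = (\<Sum>m\<in>{m \<in> Poly_Mapping.keys G. Poly_Mapping.keys m \<subseteq> B}.
      Poly_Mapping.single m (Poly_Mapping.lookup G m))" for B
  have lookup_part: "Poly_Mapping.lookup (part B) m =
      (if Poly_Mapping.keys m \<subseteq> B then Poly_Mapping.lookup G m else 0)" for B m
    by (auto simp: part_def lookup_sum lookup_single when_def in_keys_iff)
  have part: "part B \<in> forms B d" for B
  proof -
    have "Poly_Mapping.keys m \<subseteq> B \<and> m \<in> Poly_Mapping.keys G" if "m \<in> Poly_Mapping.keys (part B)" for m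
      using that unfolding lookup_not_eq_zero_eq_in_keys[symmetric] lookup_part by (auto split: if_splits)
    then show ?thesis using G by (auto simp: forms_def polys_def)
  qed
  have disj: "Poly_Mapping.keys m \<subseteq> A \<longleftrightarrow> \<not> Poly_Mapping.keys m \<subseteq> {..n} - A"
    if m: "m \<in> Poly_Mapping.keys G" for m
  proof -
    have m': "Poly_Mapping.keys m \<subseteq> {..n}" "mdeg m = d" using m G by (auto simp: forms_def polys_def)
    \<comment> \<open>The constant monomial would lie on both sides; \<open>d > 0\<close> excludes
      it.\<close>
    have "Poly_Mapping.keys m \<noteq> {}" using m'(2) d by auto
    moreover have False if "i \<in> Poly_Mapping.keys m" "i \<in> A" "j \<in> Poly_Mapping.keys m" "j \<notin> A" for i j
    proof -
      have "i \<noteq> j" using that by auto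
      then have "m = (m - Poly_Mapping.single i 1 - Poly_Mapping.single j 1) + Poly_Mapping.single i 1 + Poly_Mapping.single j 1"
        using that by (intro poly_mapping_eqI)
          (auto simp: lookup_add lookup_minus lookup_single when_def in_keys_iff)
      then have "Poly_Mapping.lookup G ((m - Poly_Mapping.single i 1 - Poly_Mapping.single j 1) + Poly_Mapping.single i 1 + Poly_Mapping.single j 1) \<noteq> 0"
        using m by (simp add: in_keys_iff)
      then have "Poly_Mapping.lookup (partial i (partial j G)) (m - Poly_Mapping.single i 1 - Poly_Mapping.single j 1) \<noteq> 0"
        by (simp add: lookup_partial del: of_nat_Suc)
      then show False using mixed[of i j] that m' by (auto simp: G_def)
    qed
    ultimately show ?thesis using m'(1) by blast
  qed
  have G_split: "G = part A + part ({..n} - A)"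
    using disj by (intro poly_mapping_eqI) (auto simp: lookup_add lookup_part in_keys_iff)

  \<comment> \<open>Renames variables by the inverse of \<open>\<pi>\<close>, which the permuted
    coordinates \<open>y (\<pi> i)\<close> undo. Below, \<open>f\<close> only has variables in the
    image of \<open>K\<close>, where \<open>inv_into\<close> is a genuine inverse.\<close>
  define pull where "pull K f = substitute (\<lambda>i. Var (inv_into K \<pi> i)) f" for K f
  have pull: "pull K f \<in> forms K d \<and> substitute (\<lambda>i. y (\<pi> i)) (pull K f) = substitute y f"
    if "bij_betw \<pi> K B" "f \<in> forms B d" for K B f
  proof
    show "pull K f \<in> forms K d"
      unfolding pull_def using bij_betw_imp_surj_on[OF that(1)]
      by (intro forms_substitute[OF that(2)] forms_Var inv_into_into) simp
    have "substitute (\<lambda>i. y (\<pi> i)) (pull K f) = mp_eval Const (\<lambda>i. y (\<pi> (inv_into K \<pi> i))) f"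
      by (simp add: pull_def hom_mp_eval[OF subst.comm_ring_hom_axioms] substitute_Const substitute_Var)
    also have "\<dots> = substitute y f"
      using that by (intro mp_eval_cong[OF forms_polys]) (auto simp: bij_betw_inv_into_right)
    finally show "substitute (\<lambda>i. y (\<pi> i)) (pull K f) = substitute y f" .
  qed
  have "substitute y G = mp_eval Const (\<lambda>i. substitute y (w i)) g"
    by (simp add: G_def hom_mp_eval[OF subst.comm_ring_hom_axioms] substitute_Const)
  also have "\<dots> = substitute Var g"
    using yw by (intro mp_eval_cong[OF forms_polys[OF g]]) auto
  finally have "g = substitute y G" by (simp add: substitute_Var_id)
  then have "g = substitute (\<lambda>i. y (\<pi> i)) (pull {..l} (part A)) +
      substitute (\<lambda>i. y (\<pi> i)) (pull {l+1..n} (part ({..n} - A)))"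
    using pull[OF \<pi>1 part] pull[OF \<pi>2 part] by (metis G_split subst.hom_add)
  moreover have "linear_coordinates n (\<lambda>i. y (\<pi> i))"
    unfolding linear_coordinates_def
  proof (intro conjI allI impI)
    show "y (\<pi> i) \<in> S_comp n 1" if "i \<le> n" for i using y \<pi>_le that by blast
    fix c k assume "(\<Sum>i\<le>n. Const (c i) * y (\<pi> i)) = 0" and k: "k \<le> n"
    \<comment> \<open>Applying \<open>w\<close> yields a relation among distinct variables;
      differentiating along \<open>\<pi> k\<close> then isolates \<open>c k\<close>.\<close>
    then have "0 = substitute w (\<Sum>i\<le>n. Const (c i) * y (\<pi> i))" by simp
    also have "\<dots> = (\<Sum>i\<le>n. Const (c i) * Var (\<pi> i))"
      using wy \<pi>_le by (simp add: subst.hom_sum subst.hom_mult substitute_Const)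
    finally have "partial (\<pi> k) (\<Sum>i\<le>n. Const (c i) * Var (\<pi> i)) = 0" by simp
    moreover have "partial (\<pi> k) (\<Sum>i\<le>n. Const (c i) * Var (\<pi> i)) = (\<Sum>i\<le>n. if i = k then Const (c i) else 0)"
      unfolding partial_sum using \<pi> k
      by (intro sum.cong) (auto simp: partial_Const_mult partial_Var bij_betw_def inj_on_eq_iff)
    ultimately show "c k = 0" using k by simp
  qed
  ultimately show ?thesis
    unfolding sebastiani_thom_def using ln pull[OF \<pi>1 part] pull[OF \<pi>2 part] by blast
qed

text \<open>In the new coordinates \<open>g\<close> has degree at most 1 in
  \<open>x\<^sub>a\<close>, so it is \<open>x\<^sub>a A + B\<close> with \<open>A\<close> and
  \<open>B\<close> free of \<open>x\<^sub>a\<close>. Were \<open>A\<close> zero, the chain rule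
  would give a syzygy of \<open>g\<close> with constant coefficients, against
  \<open>mdr\<close>.\<close>

lemma singularity_of_multiplicity_if_second_partial_0:
  fixes y w :: "nat \<Rightarrow> mpoly"
  assumes y: "\<And>i. i \<le> n \<Longrightarrow> y i \<in> S_comp n 1" and w: "\<And>i. i \<le> n \<Longrightarrow> w i \<in> S_comp n 1"
    and yw: "\<And>i. i \<le> n \<Longrightarrow> substitute y (w i) = Var i"
    and wy: "\<And>i. i \<le> n \<Longrightarrow> substitute w (y i) = Var i"
    and d: "d > 2" and g: "g \<in> S_comp n d" and mdr: "mdr0 n g > 0"
    and a: "a \<le> n" "partial a (partial a (substitute w g)) = 0"
  shows "\<exists>p. singularity_of_multiplicity n d g p (d - 1)"
proof
  define G where "G = substitute w g"
  have G: "G \<in> S_comp n d" unfolding G_def using g w by (intro forms_substitute) auto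
  define A where "A = partial a G"
  define B where "B = G - Var a * A"
  have d': "Suc (d - 1) = d" using d by simp
  have dA: "partial a A = 0" using a(2) by (simp add: A_def G_def)
  have A': "A \<in> S_comp n (d - 1)" unfolding A_def using G d' by (intro forms_partial) simp
  have A: "A \<in> forms ({..n} - {a}) (d - 1)" using A' dA by (rule partial_eq_0_forms)
  have V: "Var a \<in> S_comp n 1" using a by (intro forms_Var) auto
  have "B \<in> S_comp n d" unfolding B_def
    using forms_mult[OF V A'] G d' by (intro forms_diff) auto
  moreover have "partial a (G - Var a * A) = partial a G - partial a (Var a * A)"
    by (metis partial_add add_diff_cancel_right' diff_add_cancel)
  then have "partial a B = 0" by (simp add: B_def partial_mult partial_Var dA) (simp add: A_def)
  ultimately have B: "B \<in> forms ({..n} - {a}) d" by (rule partial_eq_0_forms)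
  have inv: "substitute y (substitute w f) = f" if "f \<in> S_ring n" for f
  proof -
    have "substitute y (substitute w f) = mp_eval Const (\<lambda>i. substitute y (w i)) f"
      by (simp add: hom_mp_eval[OF subst.comm_ring_hom_axioms] substitute_Const)
    also have "\<dots> = substitute Var f" using yw that by (intro mp_eval_cong[of _ "{..n}"]) auto
    finally show ?thesis by (simp add: substitute_Var_id)
  qed
  have gS: "g \<in> S_ring n" using g by (rule forms_polys)
  have g_eq: "g = y a * substitute y A + substitute y B"
    using inv[OF gS] by (simp add: B_def G_def[symmetric] subst.hom_minus subst.hom_mult substitute_Var)
  have nz: "substitute y A \<noteq> 0"
  proof
    assume 0: "substitute y A = 0"
    have deg0: "partial a (w j) \<in> S_comp n 0" if "j \<le> n" for j
      using forms_partial[of "w j" "{..n}" 0] w[OF that] by simp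
    have "(\<Sum>j\<le>n. partial a (w j) * partial j g) = (\<Sum>j\<le>n. substitute y (partial a (w j)) * partial j g)"
    proof (intro sum.cong refl arg_cong2[of _ _ _ _ "(*)"])
      fix j assume "j \<in> {..n}"
      then have "partial a (w j) = Const (Poly_Mapping.lookup (partial a (w j)) 0)"
        by (intro forms_0_eq_Const[OF deg0]) simp
      then show "partial a (w j) = substitute y (partial a (w j))"
        by (metis substitute_Const)
    qed
    also have "\<dots> = substitute y A"
      unfolding A_def G_def partial_substitute[OF gS finite_atMost] subst.hom_sum subst.hom_mult
      by (intro sum.cong refl) (simp add: inv polys_partial gS mult.commute)
    also note 0
    finally have w0: "partial a (w j) = 0" if "j \<le> n" for j
      using AR_eq_0_if_less_mdr0[where a = "\<lambda>j. partial a (w j)", OF mdr deg0 _ that] by blast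
    \<comment> \<open>If no \<open>w j\<close> involves \<open>x\<^sub>a\<close>, neither does
      \<open>y a\<close> composed with \<open>w\<close>, but that is the variable
      \<open>x\<^sub>a\<close> itself.\<close>
    have "partial a (substitute w (y a)) = 0"
      using partial_substitute[OF forms_polys[OF y[OF a(1)]] finite_atMost] w0 by simp
    then show False using wy a by (simp add: partial_Var)
  qed
  \<comment> \<open>The image of the \<open>a\<close>-th unit vector under \<open>w\<close>: the
    point where \<open>y a\<close> is 1 and the other coordinates \<open>y i\<close> are 0.\<close>
  define p where "p = (\<lambda>j. eval_at (\<lambda>i. if i = a then 1 else 0) (w j))"
  have "eval_at p (y i) = (if i = a then 1 else 0)" if "i \<le> n" for i
  proof -
    have "eval_at p (y i) = eval_at (\<lambda>i. if i = a then 1 else 0) (substitute w (y i))"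
      by (simp add: hom_mp_eval[OF eval.comm_ring_hom_axioms] p_def)
    then show ?thesis using wy that by simp
  qed
  from singularity_of_multiplicity_if_linear[OF d a(1) y this A B nz g_eq]
  show "singularity_of_multiplicity n d g p (d - 1)" .
qed

theorem theorem1p4:
  fixes n d :: nat and f g :: mpoly
  assumes "n \<ge> 1" and "d > 3"
    and "homogeneous n d f" and "homogeneous n d g"
    and "\<not> same_hypersurface f g"
    and "mdr0 n g \<ge> 3"
    and "orbit_tangent_space n d f = orbit_tangent_space n d g"
  shows "(\<exists>p. singularity_of_multiplicity n d g p (d - 1)) \<or> sebastiani_thom n d g"
proof -
  obtain e where e: "d = Suc e" using assms(2) by (cases d) auto
  have f: "f \<in> S_comp n d" "f \<noteq> 0" and g: "g \<in> S_comp n d"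
    using assms by (auto simp: homogeneous_def)
  have "\<exists>c. partial j f = (\<Sum>l\<le>n. Const (c l) * partial l g)" if "j \<le> n" for j
    using partial_eq_linear_combination[of n f e g j] assms f g that unfolding e by blast
  then obtain c where c: "\<And>j. j \<le> n \<Longrightarrow> partial j f = (\<Sum>l\<le>n. Const (c j l) * partial l g)"
    by metis
  have nonscalar: "\<not> (\<exists>t. \<forall>i\<le>n. \<forall>j\<le>n. c i j = (if i = j then t else 0))"
  proof
    assume "\<exists>t. \<forall>i\<le>n. \<forall>j\<le>n. c i j = (if i = j then t else 0)"
    then obtain t where t: "\<And>i j. i \<le> n \<Longrightarrow> j \<le> n \<Longrightarrow> c i j = (if i = j then t else 0)" by blast
    have "partial j f = Const t * partial j g" if "j \<le> n" for j
    proof -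
      have "partial j f = (\<Sum>l\<le>n. if l = j then Const t * partial l g else 0)"
        unfolding c[OF that] using t that by (intro sum.cong) auto
      then show ?thesis using that by simp
    qed
    then have "of_nat d * f = of_nat d * (Const t * g)"
      unfolding euler_identity[OF f(1) finite_atMost, symmetric]
        mult.left_commute[of "of_nat d"] euler_identity[OF g finite_atMost, symmetric]
      by (simp add: sum_distrib_left mult_ac)
    then have "f = Const t * g" using assms(2) by simp
    \<comment> \<open>\<open>same_hypersurface\<close> asks for a nonzero factor, which
      \<open>f \<noteq> 0\<close> supplies.\<close>
    moreover have "t \<noteq> 0" using calculation f by auto
    ultimately show False using assms(5) by (auto simp: same_hypersurface_def)
  qed
  \<comment> \<open>Both sides are the second derivative of \<open>f\<close> along \<open>j\<close>
    and \<open>k\<close>, computed from either component of its gradient.\<close>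
  have sym: "(\<Sum>l\<le>n. Const (c j l) * partial k (partial l g)) =
      (\<Sum>l\<le>n. Const (c k l) * partial j (partial l g))" if "j \<le> n" "k \<le> n" for j k
    using partial_commute[of k j f] that by (simp add: c partial_sum partial_Const_mult)
  from adapted_coordinates[OF forms_polys[OF g] sym nonscalar] obtain y w where
    yw: "\<And>i. i \<le> n \<Longrightarrow> y i \<in> S_comp n 1" "\<And>i. i \<le> n \<Longrightarrow> w i \<in> S_comp n 1"
      "\<And>i. i \<le> n \<Longrightarrow> substitute y (w i) = Var i" "\<And>i. i \<le> n \<Longrightarrow> substitute w (y i) = Var i"
    and cases: "(\<exists>a\<le>n. partial a (partial a (substitute w g)) = 0) \<or>
     (\<exists>A. A \<noteq> {} \<and> A \<subset> {..n} \<and>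
        (\<forall>i\<in>A. \<forall>j\<in>{..n} - A. partial i (partial j (substitute w g)) = 0))"
    by blast
  from cases show ?thesis
  proof (elim disjE exE conjE)
    fix a assume "a \<le> n" "partial a (partial a (substitute w g)) = 0"
    then show ?thesis
      using singularity_of_multiplicity_if_second_partial_0[OF yw _ g] assms by simp
  next
    fix A assume "A \<noteq> {}" "A \<subset> {..n}"
      "\<forall>i\<in>A. \<forall>j\<in>{..n} - A. partial i (partial j (substitute w g)) = 0"
    then show ?thesis
      using sebastiani_thom_if_split[OF yw g] assms by simp
  qed
qed

end
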